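(* Let $\epsilon=(\epsilon_y)_{y\in\mathbb Z}$ be an orientation sequence satisfying the standing assumptions below, with joint law $\nu$. Then for $\nu$-almost every realization of $\epsilon$, the simple random walk $(M_n)_{n\ge 0}$ on the FKG-horizontally oriented lattice $\mathbb L^\epsilon$ is transient.
   Context: Standing assumptions on the orientations. $(\epsilon_y)_{y\in\mathbb Z}$ is a stationary sequence of $\{-1,+1\}$-valued random variables with $\mathbb P[\epsilon_0=+1]=\mathbb P[\epsilon_0=-1]=\tfrac12$, such that: (i) they are associated: for every finite collection $(\epsilon_{y_1},\dots,\epsilon_{y_k})$ and all coordinatewise nondecreasing functions $f,g:\{-1,+1\}^k\to\mathbb R$, $\mathrm{Cov}\big(f(\epsilon_{y_1},\dots,\epsilon_{y_k}),g(\epsilon_{y_1},\dots,\epsilon_{y_k})\big)\ge 0$; (ii) summable power-law decay of correlations: there is $\alpha>1$ with $\mathbb E[\epsilon_0\epsilon_y]=O(|y|^{-\alpha})$ as $|y|\to\infty$. The FKG-horizontally oriented lattice $\mathbb L^\epsilon$ is the directed graph with vertex set $\mathbb Z^2$ in which $(u,v)$, $u=(u_1,u_2)$, $v=(v_1,v_2)$, is a directed edge iff either $v_1=u_1$ and $v_2=u_2\pm1$, or $v_2=u_2$ and $v_1=u_1+\epsilon_{u_2}$. Thus every vertex has exactly three outgoing edges. For a fixed realization of $\epsilon$, the simple random walk $(M_n)_{n\ge0}$ on $\mathbb L^\epsilon$ is the Markov chain on $\mathbb Z^2$ started at $(0,0)$ that moves from $u$ to each of its three out-neighbours with probability $1/3$.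 *)

theory Defs
  imports "HOL-Probability.Probability"
begin

text \<open>Orientation environments are functions e :: int \<Rightarrow> int (values in {-1,+1}).
  Vertices of the lattice are pairs (u1,u2) :: int \<times> int.\<close>

definition out_nbrs :: "(int \<Rightarrow> int) \<Rightarrow> int \<times> int \<Rightarrow> (int \<times> int) set" where
  "out_nbrs e u = {(fst u, snd u + 1), (fst u, snd u - 1), (fst u + e (snd u), snd u)}"

text \<open>The move with label c \<in> {0,1,2}: up, down, horizontal along e (snd u).
  For e with values in {-1,1} these are exactly the three (distinct) out-neighbours.\<close>
definition lstep :: "(int \<Rightarrow> int) \<Rightarrow> int \<times> int \<Rightarrow> nat \<Rightarrow> int \<times> int" where
  "lstep e u c = (if c = 0 then (fst u, snd u + 1)
                  else if c = 1 then (fst u, snd u - 1)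
                  else (fst u + e (snd u), snd u))"

primrec walk :: "(int \<Rightarrow> int) \<Rightarrow> nat stream \<Rightarrow> nat \<Rightarrow> int \<times> int" where
  "walk e \<omega> 0 = (0, 0)"
| "walk e \<omega> (Suc n) = lstep e (walk e \<omega> n) (\<omega> !! n)"

definition srw_space :: "nat stream measure" where
  "srw_space = stream_space (measure_pmf (pmf_of_set {0, 1, 2 :: nat}))"

definition transient :: "(int \<Rightarrow> int) \<Rightarrow> bool" where
  "transient e \<longleftrightarrow>
     measure srw_space {\<omega> \<in> space srw_space. \<exists>n>0. walk e \<omega> n = (0, 0)} < 1"

definition orientation_assumptions :: "'a measure \<Rightarrow> (int \<Rightarrow> 'a \<Rightarrow> int) \<Rightarrow> bool" where
  "orientation_assumptions M eps \<longleftrightarrow>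
     prob_space M
   \<and> (\<forall>y. eps y \<in> measurable M (count_space UNIV))
   \<and> (\<forall>y. \<forall>\<omega>\<in>space M. eps y \<omega> \<in> {-1, 1})
   \<comment> \<open>stationarity\<close>
   \<and> (\<forall>k::int. distr M (PiM UNIV (\<lambda>_. count_space UNIV)) (\<lambda>\<omega> y. eps (y + k) \<omega>)
              = distr M (PiM UNIV (\<lambda>_. count_space UNIV)) (\<lambda>\<omega> y. eps y \<omega>))
   \<comment> \<open>symmetric marginal\<close>
   \<and> measure M {\<omega> \<in> space M. eps 0 \<omega> = 1} = 1 / 2
   \<and> measure M {\<omega> \<in> space M. eps 0 \<omega> = -1} = 1 / 2
   \<comment> \<open>association\<close>
   \<and> (\<forall>J f g. finite J \<longrightarrow>
        (\<forall>x x'. x \<in> J \<rightarrow>\<^sub>E {-1, 1} \<longrightarrow> x' \<in> J \<rightarrow>\<^sub>E {-1, 1} \<longrightarrow> (\<forall>y\<in>J. x y \<le> x' y)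
               \<longrightarrow> f x \<le> (f x' :: real) \<and> g x \<le> (g x' :: real)) \<longrightarrow>
        (\<integral>\<omega>. f (restrict (\<lambda>y. eps y \<omega>) J) * g (restrict (\<lambda>y. eps y \<omega>) J) \<partial>M)
        - (\<integral>\<omega>. f (restrict (\<lambda>y. eps y \<omega>) J) \<partial>M) * (\<integral>\<omega>. g (restrict (\<lambda>y. eps y \<omega>) J) \<partial>M)
        \<ge> 0)
   \<comment> \<open>summable power-law decay of correlations\<close>
   \<and> (\<exists>\<alpha>>1. \<exists>C N. \<forall>y::int. \<bar>y\<bar> \<ge> N \<longrightarrow>
        \<bar>\<integral>\<omega>. real_of_int (eps 0 \<omega> * eps y \<omega>) \<partial>M\<bar> \<le> C * real_of_int \<bar>y\<bar> powr (-\<alpha>))"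

end

theory Submission
  imports Defs "HOL-Real_Asymp.Real_Asymp"
begin

text \<open>It suffices that the expected number of visits to the origin, averaged over the orientations,
  is finite. Group the steps of the walk in pairs. The pairs ``up, down'' and ``horizontal, horizontal''
  both return to the current row; identifying them turns a trajectory into a word whose vertical
  motion is deterministic and whose horizontal position is \<open>S = \<Sum>\<^sub>y \<kappa>(y) \<epsilon>\<^sub>y\<close> plus an independent
  simple random walk with a number of steps of order \<open>N\<close>. The latter has local probabilities of order \<open>N\<^sup>-\<^sup>1\<^sup>/\<^sup>2\<close>
  and is carried by \<open>\<bar>s\<bar> \<le> N\<^sup>1\<^sup>/\<^sup>2\<^sup>+\<^sup>\<delta>\<close>, and the vertical bridge contributes another \<open>N\<^sup>-\<^sup>1\<^sup>/\<^sup>2\<close>; so a bound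
  \<open>P(\<bar>S\<bar> \<le> N\<^sup>1\<^sup>/\<^sup>2\<^sup>+\<^sup>\<delta>) = O(N\<^sup>-\<^sup>\<delta>)\<close> makes the series converge. For typical words \<open>\<kappa>\<close> lives on
  \<open>N\<^sup>1\<^sup>/\<^sup>2\<^sup>+\<^sup>\<delta>\<close> sites and is bounded by \<open>N\<^sup>1\<^sup>/\<^sup>2\<^sup>+\<^sup>\<delta>\<close>, hence \<open>\<Sum> \<kappa>\<^sup>2\<close> is almost of order \<open>N\<^sup>3\<^sup>/\<^sup>2\<close>, and the
  characteristic function of \<open>S\<close> at frequencies slightly above \<open>N\<^sup>-\<^sup>3\<^sup>/\<^sup>4\<close> is small: it is compared
  with the product over blocks of \<open>N\<^sup>1\<^sup>/\<^sup>8\<close> sites by Newman's inequality for associated variables, and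
  the error is controlled by the decay of correlations.\<close>

section \<open>Transience and summable return probabilities\<close>

text \<open>\<open>walk\<close> appends its last step, while this recursion consumes the head of the
  stream. That is the form in which the first letter can be integrated out and the walk restarted at
  any vertex.\<close>

primrec walk_from :: "(int \<Rightarrow> int) \<Rightarrow> int \<times> int \<Rightarrow> nat stream \<Rightarrow> nat \<Rightarrow> int \<times> int" where
  "walk_from e u \<omega> 0 = u"
| "walk_from e u \<omega> (Suc n) = walk_from e (lstep e u (shd \<omega>)) (stl \<omega>) n"

lemma walk_from_Suc: "walk_from e u \<omega> (Suc n) = lstep e (walk_from e u \<omega> n) (\<omega> !! n)"
  by (induction n arbitrary: u \<omega>) auto

lemma walk_eq_walk_from: "walk e \<omega> n = walk_from e (0, 0) \<omega> n"
  by (induction n) (auto simp del: walk_from.simps(2) simp: walk_from_Suc)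

lemma walk_from_add: "walk_from e u \<omega> (n + m) = walk_from e (walk_from e u \<omega> n) (sdrop n \<omega>) m"
  by (induction n arbitrary: u \<omega>) auto

lemma space_srw_space [simp]: "space srw_space = UNIV"
  by (simp add: srw_space_def space_stream_space)

lemma prob_space_srw_space: "prob_space srw_space"
  unfolding srw_space_def by (rule prob_space.prob_space_stream_space) (rule prob_space_measure_pmf)

lemma measurable_walk_from [measurable]: "(\<lambda>\<omega>. walk_from e u \<omega> n) \<in> measurable srw_space (count_space UNIV)"
proof (induction n)
  case 0
  then show ?case by simp
next
  case (Suc n)
  have 1: "(\<lambda>\<omega>. \<omega> !! n) \<in> measurable srw_space (count_space UNIV)"
    unfolding srw_space_def
    by (rule measurable_compose[OF measurable_snth]) simp
  have "(\<lambda>\<omega>. (\<lambda>v. lstep e v (\<omega> !! n)) (walk_from e u \<omega> n)) \<in> measurable srw_space (count_space UNIV)"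
    by (rule measurable_compose_countable[OF _ Suc]) (rule measurable_compose[OF 1], simp)
  then show ?case by (simp del: walk_from.simps(2) add: walk_from_Suc)
qed

lemma measurable_sdrop_srw [measurable]: "sdrop n \<in> measurable srw_space srw_space"
  unfolding srw_space_def by measurable

text \<open>The \<open>n\<close>-step transition probability from \<open>u\<close> to the origin, in
  backward (first-step) form.\<close>

primrec return_prob :: "(int \<Rightarrow> int) \<Rightarrow> nat \<Rightarrow> int \<times> int \<Rightarrow> real" where
  "return_prob e 0 u = of_bool (u = (0, 0))"
| "return_prob e (Suc n) u = (return_prob e n (lstep e u 0) + return_prob e n (lstep e u 1) + return_prob e n (lstep e u 2)) / 3"

lemma return_prob_nonneg: "0 \<le> return_prob e n u"
  by (induction n arbitrary: u) auto

text \<open>The Markov property at a fixed time, obtained by integrating out one letter at a time.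
  \<open>A = UNIV\<close> identifies \<open>return_prob\<close> as a probability; for a null event
  \<open>A\<close>, almost surely no visit to the origin is followed by \<open>A\<close>.\<close>

lemma emeasure_walk_from_sdrop:
  assumes A: "A \<in> sets srw_space"
  shows "emeasure srw_space {\<omega>. walk_from e u \<omega> n = (0, 0) \<and> sdrop n \<omega> \<in> A}
    = ennreal (return_prob e n u) * emeasure srw_space A"
proof (induction n arbitrary: u)
  case 0
  then show ?case by (cases "u = (0,0)") auto
next
  case (Suc n)
  let ?S = "\<lambda>n u. {\<omega>. walk_from e u \<omega> n = (0, 0) \<and> sdrop n \<omega> \<in> A}"
  have S: "?S n u \<in> sets srw_space" for n u
  proof -
    have "{\<omega> \<in> space srw_space. walk_from e u \<omega> n = (0, 0) \<and> sdrop n \<omega> \<in> A} \<in> sets srw_space"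
      using A by measurable
    then show ?thesis by simp
  qed
  have "emeasure srw_space (?S (Suc n) u) = (\<integral>\<^sup>+\<omega>. indicator (?S (Suc n) u) \<omega> \<partial>srw_space)"
    using S by (rule nn_integral_indicator[symmetric])
  also have "\<dots> = (\<integral>\<^sup>+x. (\<integral>\<^sup>+\<omega>. indicator (?S (Suc n) u) (x ## \<omega>) \<partial>srw_space) \<partial>measure_pmf (pmf_of_set {0, 1, 2 :: nat}))"
    unfolding srw_space_def
    by (rule prob_space.nn_integral_stream_space[OF prob_space_measure_pmf])
       (use S[where n="Suc n" and u=u] in \<open>simp add: srw_space_def\<close>)
  also have "\<dots> = (\<integral>\<^sup>+x. ennreal (return_prob e n (lstep e u x)) * emeasure srw_space A \<partial>measure_pmf (pmf_of_set {0, 1, 2 :: nat}))"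
  proof (rule nn_integral_cong)
    fix x
    have "(\<integral>\<^sup>+\<omega>. indicator (?S (Suc n) u) (x ## \<omega>) \<partial>srw_space) = (\<integral>\<^sup>+\<omega>. indicator (?S n (lstep e u x)) \<omega> \<partial>srw_space)"
      by (intro nn_integral_cong) (auto simp: indicator_def)
    also have "\<dots> = emeasure srw_space (?S n (lstep e u x))"
      using S by (rule nn_integral_indicator)
    finally show "(\<integral>\<^sup>+\<omega>. indicator (?S (Suc n) u) (x ## \<omega>) \<partial>srw_space) = ennreal (return_prob e n (lstep e u x)) * emeasure srw_space A"
      using Suc by simp
  qed
  also have "\<dots> = ennreal (return_prob e (Suc n) u) * emeasure srw_space A"
  proof -
    have "(\<integral>\<^sup>+x. ennreal (return_prob e n (lstep e u x)) * emeasure srw_space A \<partial>measure_pmf (pmf_of_set {0, 1, 2 :: nat}))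
      = (\<integral>\<^sup>+x. ennreal (return_prob e n (lstep e u x)) \<partial>measure_pmf (pmf_of_set {0, 1, 2 :: nat})) * emeasure srw_space A"
      by (rule nn_integral_multc) simp
    also have "(\<integral>\<^sup>+x. ennreal (return_prob e n (lstep e u x)) \<partial>measure_pmf (pmf_of_set {0, 1, 2 :: nat}))
      = ennreal (return_prob e n (lstep e u 0) + return_prob e n (lstep e u 1) + return_prob e n (lstep e u 2)) / ennreal 3"
      by (subst nn_integral_pmf_of_set) (auto simp: return_prob_nonneg add.assoc)
    also have "\<dots> = ennreal (return_prob e (Suc n) u)"
      by (subst divide_ennreal) (auto simp: return_prob_nonneg)
    finally show ?thesis .
  qed
  finally show ?case .
qed

text \<open>If a return were certain, the Markov property would make every visit be followed by
  another one, hence infinitely many visits almost surely. Summability and Borel-Cantelli allow only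
  finitely many.\<close>

lemma transient_if_summable:
  assumes "summable (\<lambda>n. return_prob e n (0, 0))"
  shows "transient e"
proof (rule ccontr)
  interpret prob_space srw_space by (rule prob_space_srw_space)
  assume nt: "\<not> transient e"
  define R where "R = {\<omega>. \<exists>n>0. walk e \<omega> n = (0, 0)}"
  have R_sets: "R \<in> sets srw_space"
  proof -
    have "{\<omega> \<in> space srw_space. \<exists>n>0. walk_from e (0,0) \<omega> n = (0, 0)} \<in> sets srw_space"
      by measurable
    then show ?thesis by (simp add: R_def walk_eq_walk_from)
  qed
  have "prob R \<ge> 1" using nt by (simp add: transient_def R_def)
  then have "prob R = 1" by (simp add: measure_ge_1_iff)
  then have "prob (- R) = 0" using prob_compl[OF R_sets] by (simp add: Compl_eq_Diff_UNIV)
  then have R0: "emeasure srw_space (- R) = 0" by (simp add: emeasure_eq_measure)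
  have R'_sets: "- R \<in> sets srw_space" using sets.compl_sets[OF R_sets] by (simp add: Compl_eq_Diff_UNIV)
  \<comment> \<open>Time \<open>n\<close> is a visit and the walk restarted there never
    returns.\<close>
  let ?B = "\<lambda>n. {\<omega>. walk e \<omega> n = (0, 0) \<and> sdrop n \<omega> \<in> - R}"
  have "AE \<omega> in srw_space. \<omega> \<notin> ?B n" for n
  proof (rule AE_I[where N = "?B n"])
    show "emeasure srw_space (?B n) = 0"
      unfolding walk_eq_walk_from emeasure_walk_from_sdrop[OF R'_sets] R0 by simp
    have "{\<omega> \<in> space srw_space. walk_from e (0,0) \<omega> n = (0, 0) \<and> sdrop n \<omega> \<in> - R} \<in> sets srw_space"
      using R'_sets by measurable
    then show "?B n \<in> sets srw_space" by (simp add: walk_eq_walk_from)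
  qed auto
  then have ae1: "AE \<omega> in srw_space. \<forall>n. \<omega> \<notin> ?B n" by (simp add: AE_all_countable)
  have m: "measure srw_space {\<omega>. walk e \<omega> n = (0,0)} = return_prob e n (0,0)" for n
    using emeasure_walk_from_sdrop[of UNIV e "(0,0)" n] sets.top[of srw_space] emeasure_space_1
    by (simp add: walk_eq_walk_from measure_def return_prob_nonneg)
  have ae2: "AE \<omega> in srw_space. eventually (\<lambda>n. \<omega> \<in> space srw_space - {\<omega>. walk e \<omega> n = (0,0)}) sequentially"
  proof (rule borel_cantelli_AE1)
    show "{\<omega>. walk e \<omega> n = (0,0)} \<in> sets srw_space" for n
    proof -
      have "{\<omega> \<in> space srw_space. walk_from e (0,0) \<omega> n = (0, 0)} \<in> sets srw_space" by measurable
      then show ?thesis by (simp add: walk_eq_walk_from)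
    qed
  qed (use assms m in \<open>auto simp: emeasure_eq_measure\<close>)
  have "AE \<omega> in srw_space. False"
    using ae1 ae2
  proof eventually_elim
    case (elim \<omega>)
    then obtain N where N: "\<And>n. n \<ge> N \<Longrightarrow> walk e \<omega> n \<noteq> (0,0)"
      by (auto simp: eventually_sequentially)
    \<comment> \<open>Outside every \<open>?B n\<close>, a visit at time \<open>n\<close> yields a
      visit at some \<open>n + m\<close> with \<open>m > 0\<close>; the start at time 0 is the first
      visit of the chain.\<close>
    have "\<exists>n\<ge>k. walk e \<omega> n = (0,0)" for k
    proof (induction k)
      case 0
      have "walk e \<omega> 0 = (0,0)" by simp
      then show ?case by blast
    next
      case (Suc k)
      then obtain n where n: "n \<ge> k" "walk e \<omega> n = (0,0)" by blast
      then have "sdrop n \<omega> \<in> R" using elim by auto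
      then obtain m where "m > 0" "walk e (sdrop n \<omega>) m = (0,0)" by (auto simp: R_def)
      then have "walk e \<omega> (n + m) = (0,0)" using n by (simp add: walk_eq_walk_from walk_from_add)
      moreover have "n + m \<ge> Suc k" using n \<open>m > 0\<close> by simp
      ultimately show ?case by blast
    qed
    then show False using N by blast
  qed
  then show False by simp
qed

section \<open>Pairing the steps of the walk\<close>

primrec srw :: "nat \<Rightarrow> int \<Rightarrow> real" where
  "srw 0 s = of_bool (s = 0)"
| "srw (Suc k) s = (srw k (s - 1) + srw k (s + 1)) / 2"

lemma srw_nonneg [simp]: "0 \<le> srw k s"
  by (induction k arbitrary: s) auto

lemma srw_eq_0: "s < - int k \<Longrightarrow> srw k s = 0"
  by (induction k arbitrary: s) auto

lemma srw_eq_0_parity: "odd (s + int k) \<Longrightarrow> srw k s = 0"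
  by (induction k arbitrary: s) auto

lemma srw_eq_binomial: "srw k (2 * int j - int k) = real (k choose j) / 2 ^ k"
proof (induction k arbitrary: j)
  case 0
  then show ?case by (cases j) auto
next
  case (Suc k)
  show ?case
  proof (cases j)
    case 0
    then show ?thesis using Suc[of 0] by (simp add: srw_eq_0)
  next
    case (Suc i)
    have "2 * int j - int (Suc k) - 1 = 2 * int i - int k" "2 * int j - int (Suc k) + 1 = 2 * int j - int k"
      using Suc by auto
    then show ?thesis
      using Suc.IH[of i] Suc.IH[of j] Suc by (simp add: field_simps)
  qed
qed

text \<open>The squared form closes under induction: consecutive central coefficients have ratio
  \<open>2 * (2n + 1) / (n + 1)\<close>, and
  \<open>(2n + 1) * (2n + 3) \<le> 4 * (n + 1)^2\<close>.\<close>

lemma central_binomial_upper: "real ((2 * n) choose n) * sqrt (2 * real n + 1) \<le> 4 ^ n"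
proof -
  have "(real ((2 * n) choose n))\<^sup>2 * (2 * real n + 1) \<le> 16 ^ n"
  proof (induction n)
    case (Suc n)
    have r: "real ((2 * Suc n) choose Suc n) * (real n + 1) = real ((2 * n) choose n) * (2 * (2 * real n + 1))"
    proof -
      have "Suc n * ((2 * Suc n) choose Suc n) = 2 * Suc n * ((2 * n + 1) choose n)"
        using binomial_absorption[of n "2 * Suc n"] by simp
      then have "Suc n * ((2 * Suc n) choose Suc n) = Suc n * (2 * ((2 * n + 1) choose n))"
        by (simp only: mult_ac)
      then have 1: "((2 * Suc n) choose Suc n) = 2 * ((2 * n + 1) choose n)"
        by (simp only: Suc_mult_cancel1)
      have "Suc n * ((2 * n + 1) choose Suc n) = (2 * n + 1) * ((2 * n) choose n)"
        using binomial_absorption[of n "2 * n + 1"] by simp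
      moreover have "((2 * n + 1) choose Suc n) = ((2 * n + 1) choose n)"
        using binomial_symmetric[of n "2 * n + 1"] by simp
      ultimately have 2: "Suc n * ((2 * n + 1) choose n) = (2 * n + 1) * ((2 * n) choose n)" by simp
      have "Suc n * ((2 * Suc n) choose Suc n) = 2 * (2 * n + 1) * ((2 * n) choose n)"
        using 1 2 by (metis mult.assoc mult.left_commute)
      moreover have "real X * (real n + 1) = real Y * (2 * (2 * real n + 1))"
        if "Suc n * X = 2 * (2 * n + 1) * Y" for X Y
        using arg_cong[OF that, of real] by (simp add: algebra_simps)
      ultimately show ?thesis by blast
    qed
    have "(real ((2 * Suc n) choose Suc n))\<^sup>2 * (2 * real (Suc n) + 1) * (real n + 1)\<^sup>2
        = (real ((2 * n) choose n))\<^sup>2 * (2 * real n + 1) * (4 * ((2 * real n + 1) * (2 * real n + 3)))"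
    proof -
      have "X\<^sup>2 * (2 * real (Suc n) + 1) * (real n + 1)\<^sup>2 = Y\<^sup>2 * (2 * real n + 1) * (4 * ((2 * real n + 1) * (2 * real n + 3)))"
        if "X * (real n + 1) = Y * (2 * (2 * real n + 1))" for X Y
      proof -
        have "X\<^sup>2 * (2 * real (Suc n) + 1) * (real n + 1)\<^sup>2 = (X * (real n + 1))\<^sup>2 * (2 * real n + 3)"
          by (simp add: power_mult_distrib)
        also have "\<dots> = Y\<^sup>2 * (2 * real n + 1) * (4 * ((2 * real n + 1) * (2 * real n + 3)))"
          unfolding that by (simp add: power2_eq_square algebra_simps)
        finally show ?thesis .
      qed
      with r show ?thesis by blast
    qed
    also have "\<dots> \<le> 16 ^ n * (16 * (real n + 1)\<^sup>2)"
      by (rule mult_mono[OF Suc]) (auto simp: power2_eq_square algebra_simps)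
    finally have "(real ((2 * Suc n) choose Suc n))\<^sup>2 * (2 * real (Suc n) + 1) * (real n + 1)\<^sup>2
      \<le> 16 ^ Suc n * (real n + 1)\<^sup>2" by simp
    then show ?case by (simp add: mult_le_cancel_right)
  qed simp
  then have "(real ((2 * n) choose n) * sqrt (2 * real n + 1))\<^sup>2 \<le> (4 ^ n)\<^sup>2"
  proof -
    have "((4::real) ^ n)\<^sup>2 = 16 ^ n" by (simp add: power2_eq_square flip: power_mult_distrib)
    with \<open>_ \<le> 16 ^ n\<close> show ?thesis by (simp add: power_mult_distrib)
  qed
  then show ?thesis by (rule power2_le_imp_le) simp
qed

text \<open>Even times reduce to the central binomial coefficient. An odd-time probability is the
  mean of two probabilities one step earlier, and the constant 2 pays for that shift of
  time.\<close>

lemma srw_upper: "srw k s \<le> 2 / sqrt (real k + 1)"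
proof -
  have even: "srw (2 * n) s \<le> 1 / sqrt (2 * real n + 1)" for n s
  proof (cases "odd (s + int (2 * n)) \<or> s < - int (2 * n)")
    case True
    then show ?thesis using srw_eq_0_parity[of s "2 * n"] srw_eq_0[of s "2 * n"] by auto
  next
    case False
    define j where "j = nat ((s + int (2 * n)) div 2)"
    have "s = 2 * int j - int (2 * n)" using False by (auto simp: j_def)
    then have "srw (2 * n) s = real ((2 * n) choose j) / 2 ^ (2 * n)" using srw_eq_binomial by metis
    also have "\<dots> \<le> real ((2 * n) choose n) / 2 ^ (2 * n)"
      using binomial_maximum'[of n j] by (simp add: divide_right_mono)
    also have "\<dots> \<le> 1 / sqrt (2 * real n + 1)"
    proof -
      have "(2::real) ^ (2 * n) = 4 ^ n" by (simp add: power_mult)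
      then show ?thesis using central_binomial_upper[of n] by (simp add: field_simps)
    qed
    finally show ?thesis .
  qed
  show ?thesis
  proof (cases "even k")
    case True
    then obtain n where k: "k = 2 * n" by blast
    have "srw k s \<le> 1 / sqrt (real k + 1)" using even[of n s] k by simp
    also have "\<dots> \<le> 2 / sqrt (real k + 1)" by (intro divide_right_mono) auto
    finally show ?thesis .
  next
    case False
    then obtain n where k: "k = Suc (2 * n)" by (elim oddE) auto
    have "srw k s \<le> 1 / sqrt (2 * real n + 1)" using even[of n "s - 1"] even[of n "s + 1"] k by simp
    also have "\<dots> \<le> 2 / sqrt (real k + 1)"
    proof -
      have "sqrt (real k + 1) \<le> sqrt (4 * (2 * real n + 1))" unfolding k by (intro real_sqrt_le_mono) simp
      also have "\<dots> = 2 * sqrt (2 * real n + 1)" unfolding real_sqrt_mult by simp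
      finally have "sqrt (real k + 1) \<le> 2 * sqrt (2 * real n + 1)" .
      moreover have "sqrt (real k + 1) > 0" "sqrt (2 * real n + 1) > 0" by (simp_all add: add_nonneg_pos)
      ultimately show ?thesis by (simp add: field_simps)
    qed
    finally show ?thesis .
  qed
qed

text \<open>An exponential Markov bound: the right side solves the recursion of \<open>srw\<close>
  exactly and dominates at time 0. Both signs of \<open>\<theta>\<close> are allowed, which covers
  both tails.\<close>

lemma srw_exp_bound: "srw k s \<le> exp (- \<theta> * real_of_int s) * cosh \<theta> ^ k"
proof (induction k arbitrary: s)
  case (Suc k)
  have "srw (Suc k) s \<le> (exp (- \<theta> * real_of_int (s - 1)) * cosh \<theta> ^ k + exp (- \<theta> * real_of_int (s + 1)) * cosh \<theta> ^ k) / 2"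
    using Suc[of "s - 1"] Suc[of "s + 1"] by simp
  also have "\<dots> = exp (- \<theta> * real_of_int s) * cosh \<theta> ^ Suc k"
    by (simp add: cosh_field_def exp_add exp_diff exp_minus algebra_simps field_simps)
  finally show ?case .
qed auto

text \<open>The law of the vertical coordinate, which does not depend on the orientations.\<close>

primrec lazy_walk :: "nat \<Rightarrow> int \<Rightarrow> real" where
  "lazy_walk 0 s = of_bool (s = 0)"
| "lazy_walk (Suc n) s = (lazy_walk n (s + 1) + lazy_walk n (s - 1) + lazy_walk n s) / 3"

lemma sum_binomial_Suc:
  fixes g :: "nat \<Rightarrow> real"
  shows "(\<Sum>k\<le>Suc n. real (Suc n choose k) * g k) = (\<Sum>k\<le>n. real (n choose k) * (g k + g (Suc k)))"
proof -
  have "(\<Sum>k\<le>Suc n. real (Suc n choose k) * g k) = g 0 + (\<Sum>k\<le>n. real (Suc n choose Suc k) * g (Suc k))"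
    by (subst sum.atMost_Suc_shift) simp
  also have "\<dots> = (g 0 + (\<Sum>k\<le>n. real (n choose Suc k) * g (Suc k))) + (\<Sum>k\<le>n. real (n choose k) * g (Suc k))"
    by (simp add: algebra_simps sum.distrib)
  also have "g 0 + (\<Sum>k\<le>n. real (n choose Suc k) * g (Suc k)) = (\<Sum>k\<le>Suc n. real (n choose k) * g k)"
    by (subst sum.atMost_Suc_shift) simp
  also have "\<dots> = (\<Sum>k\<le>n. real (n choose k) * g k)" by simp
  finally show ?thesis by (simp add: algebra_simps sum.distrib)
qed

text \<open>Condition on the number \<open>k\<close> of nonzero moves: they can be placed in
  \<open>n choose k\<close> ways and carry \<open>2 ^ k\<close> sign patterns.\<close>

lemma lazy_walk_eq_srw_mixture: "3 ^ n * lazy_walk n s = (\<Sum>k\<le>n. real (n choose k) * (2 ^ k * srw k s))"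
proof (induction n arbitrary: s)
  case (Suc n)
  have "3 ^ Suc n * lazy_walk (Suc n) s = 3 ^ n * lazy_walk n (s + 1) + 3 ^ n * lazy_walk n (s - 1) + 3 ^ n * lazy_walk n s"
    by (simp add: algebra_simps)
  also have "\<dots> = (\<Sum>k\<le>n. real (n choose k) * (2 ^ k * srw k s + 2 ^ Suc k * srw (Suc k) s))"
  proof -
    have "2 ^ Suc k * srw (Suc k) s = 2 ^ k * srw k (s + 1) + 2 ^ k * srw k (s - 1)" for k
      by (simp add: algebra_simps)
    then show ?thesis unfolding Suc by (simp only: sum.distrib distrib_left)
  qed
  also have "\<dots> = (\<Sum>k\<le>Suc n. real (Suc n choose k) * (2 ^ k * srw k s))"
    by (rule sum_binomial_Suc[symmetric])
  finally show ?case .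
qed simp

text \<open>With \<open>p = sqrt (k + 1)\<close> and \<open>q = sqrt (n + 1)\<close>, the inequality
  \<open>2 / p \<le> q / p^2 + 1 / q\<close> replaces the square root by \<open>1 / (k + 1)\<close>,
  whose binomial average is explicit by absorption. The two terms contribute 3/2 and 1 to the
  constant.\<close>

lemma lazy_walk_upper: "lazy_walk n s \<le> 5 / 2 / sqrt (real n + 1)"
proof -
  define q where "q = sqrt (real n + 1)"
  have q: "q > 0" "q * q = real n + 1" by (auto simp: q_def add_nonneg_pos)
  have *: "srw k s \<le> q / (real k + 1) + 1 / q" for k
  proof -
    define p where "p = sqrt (real k + 1)"
    have p: "p > 0" "p * p = real k + 1" by (auto simp: p_def add_nonneg_pos)
    have "2 / p \<le> q / (p * p) + 1 / q"
      using p(1) q(1) sum_squares_ge_zero[of "p - q" 0]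
      by (simp add: field_simps power2_eq_square)
    then show ?thesis using srw_upper[of k s] p by (simp add: p_def)
  qed
  have "(\<Sum>k\<le>n. real (n choose k) * (2 ^ k / (real k + 1))) \<le> 3 ^ Suc n / (2 * (real n + 1))"
  proof -
    have "real (n choose k) * (2 ^ k / (real k + 1)) = real (Suc n choose Suc k) * 2 ^ Suc k / (2 * (real n + 1))" for k
    proof -
      have "real (Suc k) * real (Suc n choose Suc k) = real (Suc n) * real (n choose k)"
        using binomial_absorption[of k "Suc n"] by (metis diff_Suc_1 of_nat_mult)
      then have "(real k + 1) * real (Suc n choose Suc k) = (real n + 1) * real (n choose k)"
        by (simp only: of_nat_Suc add.commute)
      moreover have "(k' + 1) * C' = (n' + 1) * C \<Longrightarrow> k' \<ge> 0 \<Longrightarrow> n' \<ge> 0 \<Longrightarrow>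
          C * (p / (k' + 1)) = C' * (2 * p) / (2 * (n' + 1))" for C C' k' n' p :: real
      proof -
        assume *: "(k' + 1) * C' = (n' + 1) * C" "k' \<ge> 0" "n' \<ge> 0"
        then have "C' = (n' + 1) * C / (k' + 1)" by (simp add: field_simps)
        moreover have "C' * (2 * p) / (2 * q) = C' * p / q" for q by simp
        moreover from calculation(1) * have "C * (p / (k' + 1)) = C' * p / (n' + 1)" by simp
        ultimately show ?thesis by (simp only:)
      qed
      ultimately show ?thesis unfolding power_Suc by (meson of_nat_0_le_iff)
    qed
    then have "(\<Sum>k\<le>n. real (n choose k) * (2 ^ k / (real k + 1)))
        = (\<Sum>k\<le>n. real (Suc n choose Suc k) * 2 ^ Suc k) / (2 * (real n + 1))"
      by (simp add: sum_divide_distrib)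
    also have "(\<Sum>k\<le>n. real (Suc n choose Suc k) * 2 ^ Suc k) \<le> (\<Sum>k\<le>Suc n. real (Suc n choose k) * 2 ^ k)"
      unfolding sum.atMost_Suc_shift by (simp del: binomial_Suc_Suc)
    also have "\<dots> = 3 ^ Suc n" using binomial_ring[of "2::real" 1 "Suc n"] by simp
    finally show ?thesis by (simp add: divide_right_mono)
  qed
  then have A: "(\<Sum>k\<le>n. real (n choose k) * (2 ^ k / (real k + 1))) \<le> 3 ^ Suc n / (2 * (q * q))" using q by simp
  have "3 ^ n * lazy_walk n s \<le> (\<Sum>k\<le>n. real (n choose k) * (2 ^ k * (q / (real k + 1) + 1 / q)))"
    unfolding lazy_walk_eq_srw_mixture by (intro sum_mono mult_left_mono *) auto
  also have "\<dots> = q * (\<Sum>k\<le>n. real (n choose k) * (2 ^ k / (real k + 1))) + (\<Sum>k\<le>n. real (n choose k) * 2 ^ k) / q"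
    by (simp add: sum_distrib_left sum_divide_distrib sum.distrib[symmetric] algebra_simps add_divide_distrib)
  also have "(\<Sum>k\<le>n. real (n choose k) * 2 ^ k) = 3 ^ n" using binomial_ring[of "2::real" 1 n] by simp
  also have "q * (\<Sum>k\<le>n. real (n choose k) * (2 ^ k / (real k + 1))) \<le> q * (3 ^ Suc n / (2 * (q * q)))"
    using A q by (intro mult_left_mono) auto
  also have "q * (3 ^ Suc n / (2 * (q * q))) + 3 ^ n / q = 3 ^ n * (5 / 2 / q)"
    using q(1) by (simp add: field_simps)
  finally have "3 ^ n * lazy_walk n s \<le> 3 ^ n * (5 / 2 / q)" by simp
  then have "lazy_walk n s \<le> 5 / 2 / q" by (rule mult_left_le_imp_le) simp
  then show ?thesis by (simp add: q_def)
qed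

section \<open>Averages over words of step pairs\<close>

definition pwords :: "nat \<Rightarrow> (nat \<times> nat) list set" where
  "pwords N = {c. set c \<subseteq> {0, 1, 2} \<times> {0, 1, 2} \<and> length c = N}"

text \<open>Expectation under \<open>N\<close> independent uniform pairs, that is, under the first
  \<open>2 * N\<close> steps of the walk.\<close>

definition pavg :: "nat \<Rightarrow> ((nat \<times> nat) list \<Rightarrow> real) \<Rightarrow> real" where
  "pavg N F = (\<Sum>c\<in>pwords N. F c) / 9 ^ N"

lemma finite_pwords [simp]: "finite (pwords N)"
  unfolding pwords_def by (rule finite_lists_length_eq) simp

lemma pavg_0 [simp]: "pavg 0 F = F []"
proof -
  have "pwords 0 = {[]}" by (auto simp: pwords_def)
  then show ?thesis by (simp add: pavg_def)
qed

lemma pavg_Suc: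
  "pavg (Suc N) F = (\<Sum>a\<in>{0,1,2}. \<Sum>b\<in>{0,1,2}. pavg N (\<lambda>c. F ((a, b) # c))) / 9"
proof -
  have eq: "pwords (Suc N) = (\<lambda>(p, c). p # c) ` (({0, 1, 2} \<times> {0, 1, 2}) \<times> pwords N)"
  proof (intro set_eqI iffI)
    fix c assume "c \<in> pwords (Suc N)"
    then obtain p c' where "c = p # c'" "p \<in> {0, 1, 2} \<times> {0, 1, 2}" "c' \<in> pwords N"
      by (cases c) (auto simp: pwords_def)
    then show "c \<in> (\<lambda>(p, c). p # c) ` (({0, 1, 2} \<times> {0, 1, 2}) \<times> pwords N)" by (intro image_eqI[of _ _ "(p, c')"]) auto
  next
    fix c assume "c \<in> (\<lambda>(p, c). p # c) ` (({0, 1, 2} \<times> {0, 1, 2}) \<times> pwords N)"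
    then obtain p c' where "c = p # c'" "p \<in> {0, 1, 2} \<times> {0, 1, 2}" "c' \<in> pwords N" by auto
    then show "c \<in> pwords (Suc N)" unfolding pwords_def by simp
  qed
  have "(\<Sum>c\<in>pwords (Suc N). F c) = (\<Sum>x\<in>({0, 1, 2} \<times> {0, 1, 2}) \<times> pwords N. F (fst x # snd x))"
    unfolding eq by (subst sum.reindex) (auto simp: inj_on_def case_prod_unfold)
  also have "\<dots> = (\<Sum>a\<in>{0,1,2}. \<Sum>b\<in>{0,1,2}. \<Sum>c\<in>pwords N. F ((a, b) # c))"
    by (simp only: sum.cartesian_product' fst_conv snd_conv)
  finally show ?thesis by (simp add: pavg_def add_divide_distrib)
qed

lemma pavg_mono: "(\<And>c. c \<in> pwords N \<Longrightarrow> F c \<le> G c) \<Longrightarrow> pavg N F \<le> pavg N G"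
  unfolding pavg_def by (intro divide_right_mono sum_mono) auto

lemma pavg_add: "pavg N (\<lambda>c. F c + G c) = pavg N F + pavg N G"
  by (simp add: pavg_def sum.distrib add_divide_distrib)

lemma pavg_cmult: "pavg N (\<lambda>c. k * F c) = k * pavg N F"
  by (simp add: pavg_def sum_distrib_left)

lemma pavg_sum: "pavg N (\<lambda>c. \<Sum>i\<in>I. F i c) = (\<Sum>i\<in>I. pavg N (F i))"
  unfolding pavg_def by (subst sum.swap) (simp add: sum_divide_distrib)

lemma pavg_const: "pavg N (\<lambda>c. k) = k"
  by (induction N) (auto simp: pavg_Suc)

lemma pavg_of_bool_le_1: "pavg N (\<lambda>c. of_bool (P c)) \<le> 1"
  using pavg_mono[of N "\<lambda>c. of_bool (P c)" "\<lambda>c. 1"] by (simp add: pavg_const)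

definition dy :: "nat \<Rightarrow> int" where
  "dy a = (if a = 0 then 1 else if a = 1 then -1 else 0)"

lemma dy_simps [simp]: "dy 0 = 1" "dy 1 = -1" "dy (Suc 0) = -1" "dy 2 = 0"
  by (simp_all add: dy_def)

text \<open>The pairs \<open>(0, 1)\<close> (up, down) and \<open>(2, 2)\<close> (two horizontal moves) both return to the
  same row; merging them is what makes the number of horizontal moves random given the class of
  the word: they displace by \<open>\<epsilon>\<^sub>y \<mp> \<epsilon>\<^sub>y\<close>, so each merged pair counts as one visit plus a fair sign.\<close>

definition merged_pair :: "nat \<Rightarrow> nat \<Rightarrow> bool" where
  "merged_pair a b \<longleftrightarrow> (a = 0 \<and> b = 1) \<or> (a = 2 \<and> b = 2)"

text \<open>Counts the copies of the sign of row \<open>z\<close> in the part of the displacement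
  that is fixed by the class of the pair. A merged pair displaces by 0 or by twice the sign of its
  row, so its centre is one copy of that sign. In an unmerged pair the second letter acts in row
  \<open>y + dy a\<close>.\<close>

definition occ :: "nat \<Rightarrow> nat \<Rightarrow> int \<Rightarrow> int \<Rightarrow> nat" where
  "occ a b y z = (if merged_pair a b then of_bool (z = y)
     else of_bool (a = 2 \<and> z = y) + of_bool (b = 2 \<and> z = y + dy a))"

fun n_merged :: "(nat \<times> nat) list \<Rightarrow> nat" where
  "n_merged [] = 0"
| "n_merged ((a, b) # c) = of_bool (merged_pair a b) + n_merged c"

fun end_row :: "(nat \<times> nat) list \<Rightarrow> int \<Rightarrow> int" where
  "end_row [] y = y"
| "end_row ((a, b) # c) y = end_row c (y + dy a + dy b)"

fun row_visits :: "(nat \<times> nat) list \<Rightarrow> int \<Rightarrow> int \<Rightarrow> nat" where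
  "row_visits [] y z = 0"
| "row_visits ((a, b) # c) y z = occ a b y z + row_visits c (y + dy a + dy b) z"

fun row_sum :: "(int \<Rightarrow> int) \<Rightarrow> (nat \<times> nat) list \<Rightarrow> int \<Rightarrow> int" where
  "row_sum e [] y = 0"
| "row_sum e ((a, b) # c) y = (if merged_pair a b then e y
     else of_bool (a = 2) * e y + of_bool (b = 2) * e (y + dy a)) + row_sum e c (y + dy a + dy b)"

text \<open>A merged pair in row \<open>y\<close> leads from \<open>x\<close> to \<open>x\<close> or
  \<open>x + 2 * e y\<close>, the two neighbours of \<open>x + e y\<close>. As \<open>e y\<close> is
  1 or -1, averaging over the two is one step of \<open>srw\<close>. Over the whole word this leaves
  the drift \<open>row_sum\<close> and a simple random walk with \<open>n_merged\<close>
  steps.\<close>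

lemma return_prob_eq_pavg:
  assumes "\<And>y. e y \<in> {-1, 1}"
  shows "return_prob e (2 * N) (x, y) = pavg N (\<lambda>c. srw (n_merged c) (x + row_sum e c y) * of_bool (end_row c y = 0))"
proof (induction N arbitrary: x y)
  case 0
  then show ?case by auto
next
  case (Suc N)
  let ?G = "\<lambda>x y c. srw (n_merged c) (x + row_sum e c y) * of_bool (end_row c y = 0)"
  \<comment> \<open>Both words of a merged class carry this average, so their sum recovers the two
    original terms.\<close>
  have m: "pavg N (\<lambda>c. srw (Suc (n_merged c)) (x + (e y + row_sum e c y)) * of_bool (end_row c y = 0))
      = (pavg N (?G x y) + pavg N (?G (x + e y + e y) y)) / 2"
  proof -
    have "srw (Suc k) (x + (e y + h)) = (srw k (x + h) + srw k (x + e y + e y + h)) / 2" for k h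
      using assms[of y] by (auto simp: algebra_simps)
    then have "srw (Suc (n_merged c)) (x + (e y + row_sum e c y)) * of_bool (end_row c y = 0) = (1/2) * (?G x y c + ?G (x + e y + e y) y c)" for c
      by (cases "end_row c y = 0") auto
    then show ?thesis by (simp only: pavg_cmult pavg_add)
  qed
  have e1: "x + e y + (e (y - 1) + h) = x + (e y + e (y - 1) + h)" for h by simp
  show ?case
    unfolding mult_Suc_right
    by (simp add: pavg_Suc merged_pair_def lstep_def Suc m del: srw.simps) (simp add: field_simps)
qed

lemma lazy_walk_eq_pavg: "pavg N (\<lambda>c. of_bool (end_row c y = 0)) = lazy_walk (2 * N) y"
proof (induction N arbitrary: y)
  case (Suc N)
  then show ?case by (simp add: pavg_Suc field_simps)
qed auto

section \<open>Deviation bounds for merges, exits and row visits\<close>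

lemma pavg_n_merged_power: "pavg N (\<lambda>c. r ^ n_merged c) = ((7 + 2 * r) / 9) ^ N"
proof (induction N)
  case (Suc N)
  then show ?case by (simp add: pavg_Suc merged_pair_def pavg_cmult algebra_simps)
qed auto

text \<open>Two of the nine pairs are merged, so the mean \<open>2 * N / 9\<close> exceeds
  \<open>N / 8\<close>. The exponential Markov bound with base 9/10 has rate
  \<open>(7 + 2 * (9/10)^8) / 9 / (9/10)\<close>, about 0.9705.\<close>

lemma pavg_n_merged_small: "pavg N (\<lambda>c. of_bool (8 * n_merged c \<le> N)) \<le> (98 / 100) ^ N"
proof -
  let ?r = "9 / 10 :: real"
  have "pavg N (\<lambda>c. of_bool (8 * n_merged c \<le> N)) \<le> pavg N (\<lambda>c. (1 / ?r ^ N) * (?r ^ 8) ^ n_merged c)"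
  proof (rule pavg_mono)
    fix c
    have "r ^ N \<le> r ^ (8 * n_merged c)" if "8 * n_merged c \<le> N" "0 < r" "r < 1" for r :: real
      using that by (intro power_decreasing) auto
    then have "of_bool (8 * n_merged c \<le> N) \<le> (1 / r ^ N) * r ^ (8 * n_merged c)" if "0 < r" "r < 1" for r :: real
      using that by (auto simp: field_simps)
    from this[of ?r] show "of_bool (8 * n_merged c \<le> N) \<le> (1 / ?r ^ N) * (?r ^ 8) ^ n_merged c"
      unfolding power_mult by simp
  qed
  also have "\<dots> = ((7 + 2 * ?r ^ 8) / 9 / ?r) ^ N"
  proof -
    have "1 / r ^ N * x ^ N = (x / r) ^ N" for r x :: real by (simp add: power_divide)
    then show ?thesis unfolding pavg_cmult pavg_n_merged_power by blast
  qed
  also have "\<dots> \<le> (98 / 100) ^ N"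
    by (intro power_mono) (auto simp: power_numeral_reduce field_simps)
  finally show ?thesis .
qed

lemma cosh_ge_third: "(1 + 2 * cosh b) / 3 \<le> cosh (b :: real)"
  using cosh_real_ge_1[of b] by simp

text \<open>Here \<open>s\<close> selects the upper or the lower side. While
  \<open>s * y + 1 \<le> a\<close>, the current pair stays on the near side, because its second
  letter acts at most one row away; the exponential of the vertical position then grows by at most
  \<open>cosh \<theta>\<close> per letter. Once \<open>s * y + 1 > a\<close>, the bound is at least
  1.\<close>

lemma pavg_exit:
  assumes s: "s \<in> {-1, 1 :: int}" and \<theta>: "\<theta> \<ge> 0"
  shows "pavg N (\<lambda>c. of_bool (\<exists>z. s * z > a \<and> row_visits c y z \<noteq> 0))
    \<le> exp (\<theta> * real_of_int (s * y + 1 - a)) * cosh \<theta> ^ (2 * N)"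
proof (induction N arbitrary: y)
  case 0
  then show ?case by simp
next
  case (Suc N)
  let ?E = "\<lambda>y. exp (\<theta> * real_of_int (s * y + 1 - a))"
  show ?case
  proof (cases "s * y + 1 > a")
    case True
    have "pavg (Suc N) (\<lambda>c. of_bool (\<exists>z. s * z > a \<and> row_visits c y z \<noteq> 0)) \<le> 1"
      by (rule pavg_of_bool_le_1)
    also have "1 \<le> ?E y * cosh \<theta> ^ (2 * Suc N)"
    proof -
      have "0 \<le> real_of_int (s * y + 1 - a)" using True by linarith
      then have "1 \<le> ?E y" using \<theta> by (simp only: one_le_exp_iff mult_nonneg_nonneg)
      moreover have "1 \<le> cosh \<theta> ^ (2 * Suc N)" by (intro one_le_power cosh_real_ge_1)
      ultimately show ?thesis using mult_mono[of 1 "?E y" 1 "cosh \<theta> ^ (2 * Suc N)"] by simp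
    qed
    finally show ?thesis .
  next
    case False
    have step: "pavg N (\<lambda>c. of_bool (\<exists>z. s * z > a \<and> row_visits ((i, j) # c) y z \<noteq> 0))
        \<le> exp (\<theta> * real_of_int (s * dy i)) * exp (\<theta> * real_of_int (s * dy j)) * (?E y * cosh \<theta> ^ (2 * N))" for i j
    proof -
      have "occ i j y z = 0" if "s * z > a" for z
        using that False s by (auto simp: occ_def dy_def)
      then have "pavg N (\<lambda>c. of_bool (\<exists>z. s * z > a \<and> row_visits ((i, j) # c) y z \<noteq> 0))
          \<le> pavg N (\<lambda>c. of_bool (\<exists>z. s * z > a \<and> row_visits c (y + dy i + dy j) z \<noteq> 0))"
        by (intro pavg_mono) auto
      also have "\<dots> \<le> ?E (y + dy i + dy j) * cosh \<theta> ^ (2 * N)" by (rule Suc)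
      also have "?E (y + dy i + dy j) = exp (\<theta> * real_of_int (s * dy i)) * exp (\<theta> * real_of_int (s * dy j)) * ?E y"
        by (simp add: exp_add[symmetric] algebra_simps)
      finally show ?thesis by simp
    qed
    have "pavg (Suc N) (\<lambda>c. of_bool (\<exists>z. s * z > a \<and> row_visits c y z \<noteq> 0))
      \<le> (\<Sum>i\<in>{0,1,2}. \<Sum>j\<in>{0,1,2}. exp (\<theta> * real_of_int (s * dy i)) * exp (\<theta> * real_of_int (s * dy j)) * (?E y * cosh \<theta> ^ (2 * N))) / 9"
      unfolding pavg_Suc by (intro divide_right_mono sum_mono step) auto
    also have "\<dots> = ((\<Sum>i\<in>{0,1,2}. exp (\<theta> * real_of_int (s * dy i))) / 3)\<^sup>2 * (?E y * cosh \<theta> ^ (2 * N))"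
      by (simp add: power2_eq_square algebra_simps)
    also have "(\<Sum>i\<in>{0,1,2}. exp (\<theta> * real_of_int (s * dy i))) / 3 = (1 + 2 * cosh \<theta>) / 3"
      using s by (auto simp: cosh_field_def)
    also have "((1 + 2 * cosh \<theta>) / 3)\<^sup>2 \<le> (cosh \<theta>)\<^sup>2"
      using cosh_ge_third[of \<theta>] cosh_real_ge_1[of \<theta>] by (intro power_mono) auto
    finally show ?thesis by (simp add: power2_eq_square mult_ac mult_right_mono)
  qed
qed

text \<open>The weight \<open>exp (- b * \<bar>w\<bar>)\<close> is designed to detect visits to 0.
  Away from 0 a step multiplies its mean by at most \<open>cosh b\<close>; at 0 every nonzero move
  lowers it, which leaves room for the extra factor \<open>exp (b / 2)\<close>.\<close>

lemma exp_visit_step: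
  fixes b :: real and w :: int
  assumes "b \<ge> 0"
  shows "exp (b / 2 * of_bool (w = 0)) * (\<Sum>i\<in>{0,1,2}. exp (- b * \<bar>real_of_int (w + dy i)\<bar>))
    \<le> 3 * cosh b * exp (- b * \<bar>real_of_int w\<bar>)"
proof (cases "w = 0")
  case True
  define x where "x = exp (b / 2)"
  have x: "x \<ge> 1" "exp b = x * x" using assms by (auto simp: x_def exp_add[symmetric])
  have "x * (1 + 2 * inverse (x * x)) \<le> 3 / 2 * (x * x + inverse (x * x))"
  proof -
    have "1 \<le> x * x" using mult_mono[of 1 x 1 x] x by simp
    have "x * (1 + 2 * inverse (x * x)) = x + 2 / x" using x by (simp add: field_simps)
    also have "\<dots> \<le> 3 / 2 * (x + 1 / x)" using x \<open>1 \<le> x * x\<close> by (simp add: field_simps)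
    also have "x + 1 / x \<le> x * x + inverse (x * x)"
    proof -
      have "(x * x * x * x + 1) - (x * x * x + x) = (x - 1)\<^sup>2 * (x * x + x + 1)"
        by (simp add: power2_eq_square algebra_simps)
      also have "\<dots> \<ge> 0" using x by simp
      finally have "(x * x * x + x) / (x * x) \<le> (x * x * x * x + 1) / (x * x)"
        by (intro divide_right_mono) auto
      then show ?thesis using x by (simp add: add_divide_distrib inverse_eq_divide)
    qed
    finally show ?thesis by simp
  qed
  then show ?thesis using True x(2)
    by (simp add: x_def[symmetric] cosh_field_def exp_minus algebra_simps)
next
  case False
  have *: "exp (- b * \<bar>real_of_int (w + 1)\<bar>) + exp (- b * \<bar>real_of_int (w - 1)\<bar>) = 2 * cosh b * exp (- b * \<bar>real_of_int w\<bar>)"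
  proof (cases "w > 0")
    case True
    then have "\<bar>real_of_int (w + 1)\<bar> = real_of_int w + 1" "\<bar>real_of_int (w - 1)\<bar> = real_of_int w - 1" "\<bar>real_of_int w\<bar> = real_of_int w"
      by auto
    then show ?thesis by (simp add: cosh_field_def exp_add[symmetric] algebra_simps)
  next
    case F: False
    then have "\<bar>real_of_int (w + 1)\<bar> = - real_of_int w - 1" "\<bar>real_of_int (w - 1)\<bar> = 1 - real_of_int w" "\<bar>real_of_int w\<bar> = - real_of_int w"
      using False by auto
    then show ?thesis by (simp add: cosh_field_def exp_add[symmetric] algebra_simps)
  qed
  have "exp (- b * \<bar>real_of_int w\<bar>) \<le> cosh b * exp (- b * \<bar>real_of_int w\<bar>)"
    using cosh_real_ge_1[of b] by simp
  with * have "exp (- b * \<bar>real_of_int (w + 1)\<bar>) + exp (- b * \<bar>real_of_int (w - 1)\<bar>) + exp (- b * \<bar>real_of_int w\<bar>)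
      \<le> 3 * cosh b * exp (- b * \<bar>real_of_int w\<bar>)" by linarith
  then show ?thesis using False by simp
qed

text \<open>The one-step estimate is applied twice per pair, from the last letter backwards, with
  \<open>w\<close> the row relative to \<open>z\<close>.\<close>

lemma pavg_visits:
  assumes "b \<ge> 0"
  shows "pavg N (\<lambda>c. exp (b / 2 * real (row_visits c y z)) * exp (- b * \<bar>real_of_int (end_row c y - z)\<bar>))
    \<le> exp (- b * \<bar>real_of_int (y - z)\<bar>) * cosh b ^ (2 * N)"
proof (induction N arbitrary: y)
  case 0
  then show ?case by simp
next
  case (Suc N)
  let ?f = "\<lambda>w. exp (- b * \<bar>real_of_int w\<bar>)" and ?g = "\<lambda>w :: int. exp (b / 2 * of_bool (w = 0))"
  have step: "pavg N (\<lambda>c. exp (b / 2 * real (row_visits ((i, j) # c) y z)) * ?f (end_row ((i, j) # c) y - z))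
     \<le> ?g (y - z) * (?g (y - z + dy i) * ?f (y - z + dy i + dy j)) * cosh b ^ (2 * N)" for i j
  proof -
    \<comment> \<open>Each letter accounts for at most one visit, in the row where it acts; a merged
      pair is charged to its first letter.\<close>
    have o: "real (occ i j y z) \<le> of_bool (y - z = 0) + of_bool (y - z + dy i = 0)"
      by (auto simp: occ_def dy_def merged_pair_def)
    have "exp (b / 2 * real (occ i j y z)) \<le> ?g (y - z) * ?g (y - z + dy i)"
      using mult_left_mono[OF o, of "b / 2"] assms
      by (simp add: exp_add[symmetric] distrib_left del: of_bool_eq_iff)
    then have "pavg N (\<lambda>c. exp (b / 2 * real (row_visits ((i, j) # c) y z)) * ?f (end_row ((i, j) # c) y - z))
       \<le> pavg N (\<lambda>c. (?g (y - z) * ?g (y - z + dy i)) * (exp (b / 2 * real (row_visits c (y + dy i + dy j) z)) * ?f (end_row c (y + dy i + dy j) - z)))"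
      by (intro pavg_mono) (simp add: exp_add distrib_left mult.assoc[symmetric] mult_right_mono)
    also have "\<dots> \<le> (?g (y - z) * ?g (y - z + dy i)) * (?f (y + dy i + dy j - z) * cosh b ^ (2 * N))"
      unfolding pavg_cmult by (intro mult_left_mono Suc) auto
    finally show ?thesis by (simp add: algebra_simps)
  qed
  have "pavg (Suc N) (\<lambda>c. exp (b / 2 * real (row_visits c y z)) * ?f (end_row c y - z))
     \<le> (\<Sum>i\<in>{0,1,2}. \<Sum>j\<in>{0,1,2}. ?g (y - z) * (?g (y - z + dy i) * ?f (y - z + dy i + dy j)) * cosh b ^ (2 * N)) / 9"
    unfolding pavg_Suc by (intro divide_right_mono sum_mono step) auto
  also have "\<dots> = (?g (y - z) * (\<Sum>i\<in>{0,1,2}. ?g (y - z + dy i) * (\<Sum>j\<in>{0,1,2}. ?f (y - z + dy i + dy j)))) * cosh b ^ (2 * N) / 9"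
    by (simp only: sum_distrib_left sum_distrib_right mult.assoc)
  also have "\<dots> \<le> (?g (y - z) * (\<Sum>i\<in>{0,1,2}. 3 * cosh b * ?f (y - z + dy i))) * cosh b ^ (2 * N) / 9"
    by (intro divide_right_mono mult_right_mono mult_left_mono sum_mono exp_visit_step assms) auto
  also have "\<dots> = 3 * cosh b * (?g (y - z) * (\<Sum>i\<in>{0,1,2}. ?f (y - z + dy i))) * cosh b ^ (2 * N) / 9"
    by (simp only: sum_distrib_left[symmetric] mult_ac)
  also have "\<dots> \<le> 3 * cosh b * (3 * cosh b * ?f (y - z)) * cosh b ^ (2 * N) / 9"
    using exp_visit_step[OF assms, of "y - z"]
    by (intro divide_right_mono mult_right_mono mult_left_mono) auto
  also have "\<dots> = ?f (y - z) * cosh b ^ (2 * Suc N)" by simp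
  finally show ?case .
qed

text \<open>On words ending in row 0 the endpoint weight equals
  \<open>exp (- b * \<bar>z\<bar>)\<close>. It cancels the weight of the starting row, so the bound
  is uniform in \<open>z\<close>.\<close>

lemma pavg_visits_tail:
  assumes "b \<ge> 0"
  shows "pavg N (\<lambda>c. of_bool (end_row c 0 = 0 \<and> real (row_visits c 0 z) > K)) \<le> exp (- (b / 2 * K)) * cosh b ^ (2 * N)"
proof -
  let ?h = "\<lambda>c. exp (b / 2 * real (row_visits c 0 z)) * exp (- b * \<bar>real_of_int (end_row c 0 - z)\<bar>)"
  have "pavg N (\<lambda>c. of_bool (end_row c 0 = 0 \<and> real (row_visits c 0 z) > K))
    \<le> pavg N (\<lambda>c. (exp (- (b / 2 * K)) * exp (b * \<bar>real_of_int z\<bar>)) * ?h c)"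
  proof (rule pavg_mono)
    fix c
    have "1 \<le> exp (- (b / 2 * K)) * exp (b * \<bar>real_of_int z\<bar>) * ?h c" if "end_row c 0 = 0" "real (row_visits c 0 z) > K"
      using that assms mult_left_mono[of K "real (row_visits c 0 z)" "b / 2"]
      by (simp add: exp_add[symmetric])
    then show "of_bool (end_row c 0 = 0 \<and> real (row_visits c 0 z) > K) \<le> (exp (- (b / 2 * K)) * exp (b * \<bar>real_of_int z\<bar>)) * ?h c"
      by auto
  qed
  also have "\<dots> \<le> (exp (- (b / 2 * K)) * exp (b * \<bar>real_of_int z\<bar>)) * (exp (- b * \<bar>real_of_int (0 - z)\<bar>) * cosh b ^ (2 * N))"
    unfolding pavg_cmult by (intro mult_left_mono pavg_visits assms) auto
  also have "\<dots> = exp (- (b / 2 * K)) * cosh b ^ (2 * N)"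
    by (simp add: exp_minus field_simps)
  finally show ?thesis .
qed

section \<open>Row sums as linear forms in the orientations\<close>

lemma row_sum_eq_sum_row_visits:
  assumes "finite I" "{z. row_visits c y z \<noteq> 0} \<subseteq> I"
  shows "row_sum e c y = (\<Sum>z\<in>I. int (row_visits c y z) * e z)"
  using assms(2)
proof (induction c arbitrary: y)
  case (Cons p c)
  obtain i j where p: "p = (i, j)" by fastforce
  have sup: "{z. row_visits c (y + dy i + dy j) z \<noteq> 0} \<subseteq> I" "{z. occ i j y z \<noteq> 0} \<subseteq> I"
    using Cons.prems by (auto simp: p)
  have "(\<Sum>z\<in>I. int (occ i j y z) * e z) = (if merged_pair i j then e y
     else of_bool (i = 2) * e y + of_bool (j = 2) * e (y + dy i))"
  proof -
    have pt: "(\<Sum>z\<in>I. int (of_bool (P \<and> z = v)) * e z) = of_bool P * e v" if "P \<Longrightarrow> v \<in> I" for P v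
    proof (cases P)
      case True
      then have "(\<Sum>z\<in>I. int (of_bool (P \<and> z = v)) * e z) = (\<Sum>z\<in>I. if z = v then e z else 0)"
        by (intro sum.cong) auto
      then show ?thesis using assms(1) that True by simp
    qed auto
    show ?thesis
    proof (cases "merged_pair i j")
      case True
      then have "y \<in> I" using sup(2) by (auto simp: occ_def)
      then show ?thesis using pt[of True y] True by (simp add: occ_def)
    next
      case False
      then have "i = 2 \<Longrightarrow> y \<in> I" "j = 2 \<Longrightarrow> y + dy i \<in> I" using sup(2) by (auto simp: occ_def)
      then show ?thesis using pt[of "i = 2" y] pt[of "j = 2" "y + dy i"] False
        by (simp add: occ_def distrib_right sum.distrib)
    qed
  qed
  then show ?case
    using Cons.IH[OF sup(1)] by (simp add: p distrib_right sum.distrib)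
qed simp

lemma n_merged_le_length: "n_merged c \<le> length c"
  by (induction c rule: n_merged.induct) auto

text \<open>Each merged pair is one visit to its row. This gives the total mass of the coefficients
  from which their sum of squares is later bounded below.\<close>

lemma n_merged_le_sum_row_visits:
  assumes "finite I" "{z. row_visits c y z \<noteq> 0} \<subseteq> I"
  shows "n_merged c \<le> (\<Sum>z\<in>I. row_visits c y z)"
  using assms(2)
proof (induction c arbitrary: y)
  case (Cons p c)
  obtain i j where p: "p = (i, j)" by fastforce
  have sup: "{z. row_visits c (y + dy i + dy j) z \<noteq> 0} \<subseteq> I" "{z. occ i j y z \<noteq> 0} \<subseteq> I"
    using Cons.prems by (auto simp: p)
  have "of_bool (merged_pair i j) \<le> (\<Sum>z\<in>I. occ i j y z)"
  proof (cases "merged_pair i j")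
    case True
    then have "y \<in> I" using sup(2) by (auto simp: occ_def)
    then have "occ i j y y \<le> (\<Sum>z\<in>I. occ i j y z)" using assms(1) by (intro member_le_sum) auto
    then show ?thesis using True by (simp add: occ_def)
  qed simp
  then show ?case
    using Cons.IH[OF sup(1)] by (simp add: p sum.distrib add_mono)
qed simp

section \<open>Small balls for sums of associated orientations\<close>

text \<open>Induction on \<open>L\<close>. For \<open>x = L / (L + 1)\<close>, the exponent
  \<open>1 - \<theta>\<close> is at least 1/2, so
  \<open>x powr (1 - \<theta>) \<le> sqrt x \<le> (x + 1) / 2\<close>; this is where the factor 2
  arises.\<close>

lemma sum_powr_neg_le:
  fixes \<theta> :: real
  assumes "0 < \<theta>" "\<theta> \<le> 1 / 2"
  shows "(\<Sum>r<L. (real r + 1) powr (- \<theta>)) \<le> 2 * real L powr (1 - \<theta>)"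
proof (induction L)
  case (Suc L)
  define x where "x = real L / (real L + 1)"
  have x: "0 \<le> x" "x \<le> 1" by (auto simp: x_def)
  have "x powr (1 - \<theta>) \<le> x powr (1 / 2)"
    using x assms by (cases "x = 0") (auto intro: powr_mono')
  also have "\<dots> = sqrt (x * 1)" using x by (simp add: powr_half_sqrt)
  also have "\<dots> \<le> (x + 1) / 2" using x by (intro arith_geo_mean_sqrt) auto
  finally have *: "1 - x \<le> 2 * (1 - x powr (1 - \<theta>))" by simp
  have "(real L + 1) powr (- \<theta>) = (real L + 1) powr (1 - \<theta>) * (1 - x)"
    using powr_add[of "real L + 1" "- \<theta>" 1] by (simp add: x_def field_simps)
  also have "\<dots> \<le> (real L + 1) powr (1 - \<theta>) * (2 * (1 - x powr (1 - \<theta>)))"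
    using * by (intro mult_left_mono) auto
  also have "\<dots> = 2 * (real L + 1) powr (1 - \<theta>) - 2 * ((real L + 1) * x) powr (1 - \<theta>)"
  proof -
    have "((real L + 1) * x) powr (1 - \<theta>) = (real L + 1) powr (1 - \<theta>) * x powr (1 - \<theta>)"
      using x by (intro powr_mult)
    then show ?thesis by (simp only:) (simp add: algebra_simps)
  qed
  also have "(real L + 1) * x = real L" by (simp add: x_def)
  finally show ?case using Suc by (simp add: add.commute)
qed simp

text \<open>Total correlation between a block of length \<open>L\<close> and everything before it,
  uniformly in the number of preceding blocks. The exponent is split as
  \<open>(1 + \<theta>) + \<theta>\<close>: the first part is summable over the past, and the
  second, in the position \<open>r\<close> within the block, makes the total sublinear in
  \<open>L\<close>.\<close>

lemma block_covariance_sum: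
  fixes c :: "nat \<Rightarrow> real" and \<theta> C1 :: real
  assumes \<theta>: "0 < \<theta>" "\<theta> \<le> 1 / 2" and C1: "C1 \<ge> 0"
    and c: "\<And>d. d \<ge> 1 \<Longrightarrow> c d \<le> C1 * real d powr (- (1 + 2 * \<theta>))"
  shows "\<exists>C2>0. \<forall>b L. (\<Sum>r<L. \<Sum>i<b * L. c (b * L + r - i)) \<le> C2 * real L powr (1 - \<theta>)"
proof -
  define Z where "Z = (\<Sum>j. real (Suc j) powr (- (1 + \<theta>)))"
  have sm: "summable (\<lambda>j. real (Suc j) powr (- (1 + \<theta>)))"
    using \<theta> by (subst summable_Suc_iff) (simp add: summable_real_powr_iff)
  have Z: "(\<Sum>j<n. real (Suc j) powr (- (1 + \<theta>))) \<le> Z" for n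
    unfolding Z_def by (intro sum_le_suminf sm) auto
  have Z0: "Z \<ge> 0" using Z[of 0] by simp
  have bd: "(\<Sum>r<L. \<Sum>i<n. c (n + r - i)) \<le> (2 * C1 * Z + 1) * real L powr (1 - \<theta>)" for n L
  proof -
    have inner: "(\<Sum>i<n. c (n + r - i)) \<le> C1 * Z * (real r + 1) powr (- \<theta>)" for r
    proof -
      \<comment> \<open>Here \<open>j + 1\<close> is the distance of the earlier site from the left
        edge of the block.\<close>
      have "(\<Sum>i<n. c (n + r - i)) = (\<Sum>j<n. c (Suc j + r))"
        by (rule sum.reindex_bij_witness[of _ "\<lambda>j. n - Suc j" "\<lambda>i. n - Suc i"]) (auto simp: Suc_diff_Suc)
      also have "\<dots> \<le> (\<Sum>j<n. C1 * (real (Suc j) powr (- (1 + \<theta>)) * (real r + 1) powr (- \<theta>)))"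
      proof (intro sum_mono)
        fix j
        have "c (Suc j + r) \<le> C1 * real (Suc j + r) powr (- (1 + 2 * \<theta>))" by (rule c) simp
        also have "real (Suc j + r) powr (- (1 + 2 * \<theta>)) = real (Suc j + r) powr (- (1 + \<theta>)) * real (Suc j + r) powr (- \<theta>)"
          unfolding powr_add[symmetric] by (simp add: algebra_simps)
        also have "\<dots> \<le> real (Suc j) powr (- (1 + \<theta>)) * (real r + 1) powr (- \<theta>)"
          using \<theta> by (intro mult_mono powr_mono2') auto
        finally show "c (Suc j + r) \<le> C1 * (real (Suc j) powr (- (1 + \<theta>)) * (real r + 1) powr (- \<theta>))"
          using C1 by (simp add: mult_left_mono)
      qed
      also have "\<dots> = C1 * (\<Sum>j<n. real (Suc j) powr (- (1 + \<theta>))) * (real r + 1) powr (- \<theta>)"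
        by (simp only: sum_distrib_left sum_distrib_right mult.assoc)
      also have "\<dots> \<le> C1 * Z * (real r + 1) powr (- \<theta>)"
        using Z[of n] C1 by (intro mult_right_mono mult_left_mono) auto
      finally show ?thesis .
    qed
    have "(\<Sum>r<L. \<Sum>i<n. c (n + r - i)) \<le> (\<Sum>r<L. C1 * Z * (real r + 1) powr (- \<theta>))"
      by (intro sum_mono inner)
    also have "\<dots> = C1 * Z * (\<Sum>r<L. (real r + 1) powr (- \<theta>))" by (simp only: sum_distrib_left)
    also have "\<dots> \<le> C1 * Z * (2 * real L powr (1 - \<theta>))"
      using C1 Z0 sum_powr_neg_le[OF \<theta>] by (intro mult_left_mono) auto
    also have "\<dots> \<le> (2 * C1 * Z + 1) * real L powr (1 - \<theta>)" by (simp add: algebra_simps)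
    finally show ?thesis .
  qed
  have "2 * C1 * Z + 1 > 0" using C1 Z0 by (simp add: add_nonneg_pos)
  with bd show ?thesis by blast
qed

text \<open>The Taylor error \<open>\<bar>x\<bar>^3 / 6\<close> is weakened to
  \<open>x^2 / 6\<close>, so that it can be compared with the quadratic loss of the cosine.\<close>

lemma cos_sin_quadratic:
  fixes x :: real
  assumes "\<bar>x\<bar> \<le> 1"
  shows "\<bar>cos x - (1 - x\<^sup>2 / 2)\<bar> \<le> x\<^sup>2 / 6" "\<bar>sin x - x\<bar> \<le> x\<^sup>2 / 6"
proof -
  have "cmod (iexp x - (\<Sum>k\<le>2. (\<i> * x) ^ k / fact k)) \<le> \<bar>x\<bar> ^ Suc 2 / fact (Suc 2)"
    by (rule iexp_approx1)
  also have "(\<Sum>k\<le>2. (\<i> * x) ^ k / fact k) = Complex (1 - x\<^sup>2 / 2) x"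
    by (simp add: numeral_2_eq_2 complex_eq_iff power2_eq_square)
  also have "iexp x = Complex (cos x) (sin x)" by (simp add: cis_conv_exp[symmetric] cis.code)
  also have "\<bar>x\<bar> ^ Suc 2 / fact (Suc 2) \<le> x\<^sup>2 / 6"
    using assms mult_right_mono[of "\<bar>x\<bar>" 1 "x\<^sup>2"]
    by (simp add: fact_numeral power_numeral_reduce eval_nat_numeral)
  finally have "cmod (Complex (cos x) (sin x) - Complex (1 - x\<^sup>2 / 2) x) \<le> x\<^sup>2 / 6" .
  then show "\<bar>cos x - (1 - x\<^sup>2 / 2)\<bar> \<le> x\<^sup>2 / 6" "\<bar>sin x - x\<bar> \<le> x\<^sup>2 / 6"
    using abs_Re_le_cmod[of "Complex (cos x) (sin x) - Complex (1 - x\<^sup>2 / 2) x"]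
      abs_Im_le_cmod[of "Complex (cos x) (sin x) - Complex (1 - x\<^sup>2 / 2) x"]
    by simp_all
qed

lemma abs_cos_diff_le: "\<bar>cos x - cos y\<bar> \<le> \<bar>x - y\<bar>" for x y :: real
proof -
  have "\<bar>cos x - cos y\<bar> = 2 * \<bar>sin ((x + y) / 2)\<bar> * \<bar>sin ((y - x) / 2)\<bar>"
    by (simp add: cos_diff_cos abs_mult)
  also have "\<dots> \<le> 2 * 1 * \<bar>(y - x) / 2\<bar>"
    by (intro mult_mono abs_sin_x_le_abs_x) auto
  finally show ?thesis by simp
qed

lemma abs_sin_diff_le: "\<bar>sin x - sin y\<bar> \<le> \<bar>x - y\<bar>" for x y :: real
  using abs_cos_diff_le[of "pi / 2 - x" "pi / 2 - y"] by (simp add: cos_diff)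

section \<open>Expectations of functions of finitely many orientations\<close>

locale fkg_orientation = prob_space M for M :: "'a measure" +
  fixes eps :: "int \<Rightarrow> 'a \<Rightarrow> int"
  assumes orientation: "orientation_assumptions M eps"
begin

lemma eps_measurable [measurable]: "eps y \<in> measurable M (count_space UNIV)"
  using orientation by (simp add: orientation_assumptions_def)

lemma eps_cases: "\<omega> \<in> space M \<Longrightarrow> eps y \<omega> = -1 \<or> eps y \<omega> = 1"
  using orientation by (auto simp: orientation_assumptions_def)

definition cfg :: "int set \<Rightarrow> 'a \<Rightarrow> int \<Rightarrow> int" where
  "cfg J \<omega> = restrict (\<lambda>y. eps y \<omega>) J"

text \<open>\<open>f\<close> may be arbitrary: for finite \<open>J\<close> the restricted
  configuration takes finitely many values, so everything is integrable.\<close>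

definition cexp :: "int set \<Rightarrow> ((int \<Rightarrow> int) \<Rightarrow> real) \<Rightarrow> real" where
  "cexp J f = (\<integral>\<omega>. f (cfg J \<omega>) \<partial>M)"

lemma cfg_in_PiE: "\<omega> \<in> space M \<Longrightarrow> cfg J \<omega> \<in> J \<rightarrow>\<^sub>E {-1, 1}"
  using eps_cases by (auto simp: cfg_def)

lemma integrable_cfg:
  fixes f :: "(int \<Rightarrow> int) \<Rightarrow> real"
  assumes J: "finite J"
  shows "integrable M (\<lambda>\<omega>. f (cfg J \<omega>))"
proof (rule integrable_const_bound[where B = "Max ((\<lambda>x. norm (f x)) ` (J \<rightarrow>\<^sub>E {-1, 1}))"])
  have fin: "finite (J \<rightarrow>\<^sub>E {-1, 1 :: int})" using J by (intro finite_PiE) auto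
  show "AE \<omega> in M. norm (f (cfg J \<omega>)) \<le> Max ((\<lambda>x. norm (f x)) ` (J \<rightarrow>\<^sub>E {-1, 1}))"
    using fin cfg_in_PiE by (intro AE_I2 Max_ge) auto
  have "cfg J \<in> measurable M (PiM J (\<lambda>_. count_space UNIV))"
    unfolding cfg_def by measurable
  also have "PiM J (\<lambda>_. count_space (UNIV :: int set)) = count_space (J \<rightarrow>\<^sub>E UNIV)"
    using J by (intro count_space_PiM_finite) auto
  finally show "(\<lambda>\<omega>. f (cfg J \<omega>)) \<in> borel_measurable M"
    by (rule measurable_compose) simp
qed

lemma cexp_add: "finite J \<Longrightarrow> cexp J (\<lambda>x. f x + g x) = cexp J f + cexp J g"
  unfolding cexp_def by (intro Bochner_Integration.integral_add integrable_cfg)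

lemma cexp_diff: "finite J \<Longrightarrow> cexp J (\<lambda>x. f x - g x) = cexp J f - cexp J g"
  unfolding cexp_def by (intro Bochner_Integration.integral_diff integrable_cfg)

lemma cexp_cmult: "cexp J (\<lambda>x. k * f x) = k * cexp J f"
  unfolding cexp_def by simp

lemma cexp_sum: "finite J \<Longrightarrow> cexp J (\<lambda>x. \<Sum>i\<in>I. f i x) = (\<Sum>i\<in>I. cexp J (f i))"
  unfolding cexp_def by (intro Bochner_Integration.integral_sum integrable_cfg)

lemma cexp_mono: "finite J \<Longrightarrow> (\<And>x. x \<in> J \<rightarrow>\<^sub>E {-1, 1} \<Longrightarrow> f x \<le> g x) \<Longrightarrow> cexp J f \<le> cexp J g"
  unfolding cexp_def by (intro integral_mono integrable_cfg) (use cfg_in_PiE in blast)+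

lemma cexp_const: "cexp J (\<lambda>x. k) = k"
  unfolding cexp_def by (simp add: prob_space)

lemma association:
  assumes "finite J"
    and "\<And>x x'. x \<in> J \<rightarrow>\<^sub>E {-1, 1} \<Longrightarrow> x' \<in> J \<rightarrow>\<^sub>E {-1, 1} \<Longrightarrow> (\<And>y. y \<in> J \<Longrightarrow> x y \<le> x' y) \<Longrightarrow> f x \<le> f x'"
    and "\<And>x x'. x \<in> J \<rightarrow>\<^sub>E {-1, 1} \<Longrightarrow> x' \<in> J \<rightarrow>\<^sub>E {-1, 1} \<Longrightarrow> (\<And>y. y \<in> J \<Longrightarrow> x y \<le> x' y) \<Longrightarrow> g x \<le> g x'"
  shows "cexp J (\<lambda>x. f x * g x) - cexp J f * cexp J g \<ge> 0"
proof -
  have "\<forall>J f g. finite J \<longrightarrow>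
        (\<forall>x x'. x \<in> J \<rightarrow>\<^sub>E {-1, 1} \<longrightarrow> x' \<in> J \<rightarrow>\<^sub>E {-1, 1} \<longrightarrow> (\<forall>y\<in>J. x y \<le> x' y)
               \<longrightarrow> f x \<le> (f x' :: real) \<and> g x \<le> (g x' :: real)) \<longrightarrow>
        (\<integral>\<omega>. f (restrict (\<lambda>y. eps y \<omega>) J) * g (restrict (\<lambda>y. eps y \<omega>) J) \<partial>M)
        - (\<integral>\<omega>. f (restrict (\<lambda>y. eps y \<omega>) J) \<partial>M) * (\<integral>\<omega>. g (restrict (\<lambda>y. eps y \<omega>) J) \<partial>M)
        \<ge> 0"
    using orientation unfolding orientation_assumptions_def by (elim conjE)
  from this[rule_format, of J f g] show ?thesis
    unfolding cexp_def cfg_def using assms by blast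
qed

text \<open>The functions \<open>U \<plusminus> f\<close> and \<open>V \<plusminus> g\<close> are nondecreasing, so association applies to all four
  pairs; adding the resulting inequalities cancels the mixed terms.\<close>

lemma covariance_domination:
  assumes J: "finite J"
    and f: "\<And>x x'. x \<in> J \<rightarrow>\<^sub>E {-1, 1} \<Longrightarrow> x' \<in> J \<rightarrow>\<^sub>E {-1, 1} \<Longrightarrow> (\<And>y. y \<in> J \<Longrightarrow> x y \<le> x' y) \<Longrightarrow>
        \<bar>f x' - f x\<bar> \<le> U x' - U x"
    and g: "\<And>x x'. x \<in> J \<rightarrow>\<^sub>E {-1, 1} \<Longrightarrow> x' \<in> J \<rightarrow>\<^sub>E {-1, 1} \<Longrightarrow> (\<And>y. y \<in> J \<Longrightarrow> x y \<le> x' y) \<Longrightarrow>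
        \<bar>g x' - g x\<bar> \<le> V x' - V x"
  shows "\<bar>cexp J (\<lambda>x. f x * g x) - cexp J f * cexp J g\<bar> \<le> cexp J (\<lambda>x. U x * V x) - cexp J U * cexp J V"
proof -
  have fp: "U x + f x \<le> U x' + f x'" "U x - f x \<le> U x' - f x'"
    if "x \<in> J \<rightarrow>\<^sub>E {-1, 1}" "x' \<in> J \<rightarrow>\<^sub>E {-1, 1}" "\<And>y. y \<in> J \<Longrightarrow> x y \<le> x' y" for x x'
    using f[OF that] by linarith+
  have gp: "V x + g x \<le> V x' + g x'" "V x - g x \<le> V x' - g x'"
    if "x \<in> J \<rightarrow>\<^sub>E {-1, 1}" "x' \<in> J \<rightarrow>\<^sub>E {-1, 1}" "\<And>y. y \<in> J \<Longrightarrow> x y \<le> x' y" for x x'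
    using g[OF that] by linarith+
  note lin = cexp_add[OF J] cexp_diff[OF J]
  have "0 \<le> cexp J (\<lambda>x. (U x + f x) * (V x + g x)) - cexp J (\<lambda>x. U x + f x) * cexp J (\<lambda>x. V x + g x)"
    by (rule association[OF J fp(1) gp(1)])
  moreover have "0 \<le> cexp J (\<lambda>x. (U x - f x) * (V x - g x)) - cexp J (\<lambda>x. U x - f x) * cexp J (\<lambda>x. V x - g x)"
    by (rule association[OF J fp(2) gp(2)])
  moreover have "0 \<le> cexp J (\<lambda>x. (U x + f x) * (V x - g x)) - cexp J (\<lambda>x. U x + f x) * cexp J (\<lambda>x. V x - g x)"
    by (rule association[OF J fp(1) gp(2)])
  moreover have "0 \<le> cexp J (\<lambda>x. (U x - f x) * (V x + g x)) - cexp J (\<lambda>x. U x - f x) * cexp J (\<lambda>x. V x + g x)"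
    by (rule association[OF J fp(2) gp(1)])
  ultimately show ?thesis
    unfolding distrib_left distrib_right left_diff_distrib right_diff_distrib lin
    by (simp add: algebra_simps)
qed

text \<open>The characteristic function of \<open>U\<close> at frequency 1, kept as a pair of real
  expectations; other frequencies are obtained by scaling \<open>U\<close>.\<close>

definition chf :: "int set \<Rightarrow> ((int \<Rightarrow> int) \<Rightarrow> real) \<Rightarrow> complex" where
  "chf J U = Complex (cexp J (\<lambda>x. cos (U x))) (cexp J (\<lambda>x. sin (U x)))"

text \<open>Sine and cosine are 1-Lipschitz, so along the order their increments are dominated by
  those of \<open>U\<close> and \<open>V\<close>. The addition formulas leave four covariances, two
  in the real part and two in the imaginary part, each at most the covariance of \<open>U\<close>
  and \<open>V\<close>.\<close>

lemma newman_inequality: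
  assumes J: "finite J"
    and U: "\<And>x x'. x \<in> J \<rightarrow>\<^sub>E {-1, 1} \<Longrightarrow> x' \<in> J \<rightarrow>\<^sub>E {-1, 1} \<Longrightarrow> (\<And>y. y \<in> J \<Longrightarrow> x y \<le> x' y) \<Longrightarrow> U x \<le> U x'"
    and V: "\<And>x x'. x \<in> J \<rightarrow>\<^sub>E {-1, 1} \<Longrightarrow> x' \<in> J \<rightarrow>\<^sub>E {-1, 1} \<Longrightarrow> (\<And>y. y \<in> J \<Longrightarrow> x y \<le> x' y) \<Longrightarrow> V x \<le> V x'"
  shows "cmod (chf J (\<lambda>x. U x + V x) - chf J U * chf J V) \<le> 4 * (cexp J (\<lambda>x. U x * V x) - cexp J U * cexp J V)"
proof -
  have c: "\<bar>cos b - cos a\<bar> \<le> b - a" if "a \<le> b" for a b :: real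
    using abs_cos_diff_le[of b a] that by simp
  have s: "\<bar>sin b - sin a\<bar> \<le> b - a" if "a \<le> b" for a b :: real
    using abs_sin_diff_le[of b a] that by simp
  note dom = covariance_domination[OF J]
  let ?K = "cexp J (\<lambda>x. U x * V x) - cexp J U * cexp J V"
  have cc: "\<bar>cexp J (\<lambda>x. cos (U x) * cos (V x)) - cexp J (\<lambda>x. cos (U x)) * cexp J (\<lambda>x. cos (V x))\<bar> \<le> ?K"
    by (rule dom) (auto intro!: c U V)
  have ss: "\<bar>cexp J (\<lambda>x. sin (U x) * sin (V x)) - cexp J (\<lambda>x. sin (U x)) * cexp J (\<lambda>x. sin (V x))\<bar> \<le> ?K"
    by (rule dom) (auto intro!: s U V)
  have cs: "\<bar>cexp J (\<lambda>x. cos (U x) * sin (V x)) - cexp J (\<lambda>x. cos (U x)) * cexp J (\<lambda>x. sin (V x))\<bar> \<le> ?K"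
    by (rule dom) (auto intro!: c s U V)
  have sc: "\<bar>cexp J (\<lambda>x. sin (U x) * cos (V x)) - cexp J (\<lambda>x. sin (U x)) * cexp J (\<lambda>x. cos (V x))\<bar> \<le> ?K"
    by (rule dom) (auto intro!: c s U V)
  let ?D = "chf J (\<lambda>x. U x + V x) - chf J U * chf J V"
  have "cmod ?D \<le> \<bar>Re ?D\<bar> + \<bar>Im ?D\<bar>" by (rule cmod_le)
  also have "\<dots> \<le> 2 * ?K + 2 * ?K"
    using cc ss cs sc unfolding chf_def
    by (simp add: cos_add sin_add cexp_add[OF J] cexp_diff[OF J])
  finally show ?thesis by simp
qed

text \<open>For mean zero and second moment \<open>v\<close>, the expected cosine lies between 0 and
  \<open>1 - v / 3\<close>, and the expected sine is at most \<open>v / 6\<close> in modulus. The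
  sum of the moduli is at most \<open>1 - v / 6\<close>.\<close>

lemma chf_small_argument:
  assumes J: "finite J"
    and U: "\<And>x. x \<in> J \<rightarrow>\<^sub>E {-1, 1} \<Longrightarrow> \<bar>U x\<bar> \<le> 1" and mean: "cexp J U = 0"
  shows "cmod (chf J U) \<le> exp (- cexp J (\<lambda>x. (U x)\<^sup>2) / 6)"
proof -
  let ?V = "cexp J (\<lambda>x. (U x)\<^sup>2)"
  have V1: "?V \<le> 1"
    using cexp_mono[OF J, of "\<lambda>x. (U x)\<^sup>2" "\<lambda>x. 1"] U by (simp add: cexp_const abs_square_le_1)
  have V0: "?V \<ge> 0"
    using cexp_mono[OF J, of "\<lambda>x. 0" "\<lambda>x. (U x)\<^sup>2"] by (simp add: cexp_const)
  have cq: "1 - (2 / 3) * u\<^sup>2 \<le> cos u" "cos u \<le> 1 - (1 / 3) * u\<^sup>2"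
    "u - (1 / 6) * u\<^sup>2 \<le> sin u" "sin u \<le> u + (1 / 6) * u\<^sup>2" if "\<bar>u\<bar> \<le> 1" for u :: real
    using cos_sin_quadratic[OF that] by linarith+
  have "cexp J (\<lambda>x. cos (U x)) \<le> cexp J (\<lambda>x. 1 - (1 / 3) * (U x)\<^sup>2)"
    by (rule cexp_mono[OF J]) (rule cq U)+
  moreover have "cexp J (\<lambda>x. 1 - (2 / 3) * (U x)\<^sup>2) \<le> cexp J (\<lambda>x. cos (U x))"
    by (rule cexp_mono[OF J]) (rule cq U)+
  moreover have "cexp J (\<lambda>x. sin (U x)) \<le> cexp J (\<lambda>x. U x + (1 / 6) * (U x)\<^sup>2)"
    by (rule cexp_mono[OF J]) (rule cq U)+
  moreover have "cexp J (\<lambda>x. U x - (1 / 6) * (U x)\<^sup>2) \<le> cexp J (\<lambda>x. sin (U x))"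
    by (rule cexp_mono[OF J]) (rule cq U)+
  ultimately have "cexp J (\<lambda>x. cos (U x)) \<le> 1 - ?V / 3" "0 \<le> cexp J (\<lambda>x. cos (U x))"
    "\<bar>cexp J (\<lambda>x. sin (U x))\<bar> \<le> ?V / 6"
    using V1 V0 unfolding cexp_add[OF J] cexp_diff[OF J] cexp_cmult cexp_const mean by linarith+
  then have "cmod (chf J U) \<le> 1 - ?V / 6"
    using cmod_le[of "chf J U"] unfolding chf_def by simp
  also have "\<dots> \<le> exp (- ?V / 6)" using exp_ge_add_one_self[of "- ?V / 6"] by simp
  finally show ?thesis .
qed

section \<open>Stationarity and the correlation function\<close>

lemma shift_invariant_integral:
  fixes g :: "(int \<Rightarrow> int) \<Rightarrow> real"
  assumes [measurable]: "g \<in> borel_measurable (PiM UNIV (\<lambda>_. count_space UNIV))"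
  shows "(\<integral>\<omega>. g (\<lambda>y. eps (y + k) \<omega>) \<partial>M) = (\<integral>\<omega>. g (\<lambda>y. eps y \<omega>) \<partial>M)"
proof -
  have m: "(\<lambda>\<omega> y. eps (y + j) \<omega>) \<in> measurable M (PiM UNIV (\<lambda>_. count_space UNIV))" for j
    by (rule measurable_PiM_single') auto
  have "distr M (PiM UNIV (\<lambda>_. count_space UNIV)) (\<lambda>\<omega> y. eps (y + k) \<omega>)
              = distr M (PiM UNIV (\<lambda>_. count_space UNIV)) (\<lambda>\<omega> y. eps y \<omega>)"
    using orientation unfolding orientation_assumptions_def by (elim conjE) (erule spec)
  then have "integral\<^sup>L (distr M (PiM UNIV (\<lambda>_. count_space UNIV)) (\<lambda>\<omega> y. eps (y + k) \<omega>)) g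
    = integral\<^sup>L (distr M (PiM UNIV (\<lambda>_. count_space UNIV)) (\<lambda>\<omega> y. eps y \<omega>)) g" by simp
  then show ?thesis using m[of k] m[of 0] by (simp add: integral_distr)
qed

lemma eps_mean: "(\<integral>\<omega>. real_of_int (eps y \<omega>) \<partial>M) = 0"
proof -
  have "(\<integral>\<omega>. real_of_int (eps y \<omega>) \<partial>M) = (\<integral>\<omega>. real_of_int (eps 0 \<omega>) \<partial>M)"
    using shift_invariant_integral[of "\<lambda>e. real_of_int (e 0)" y] by simp
  also have "\<dots> = (\<integral>\<omega>. 2 * indicator {\<omega> \<in> space M. eps 0 \<omega> = 1} \<omega> - 1 \<partial>M)"
  proof (rule Bochner_Integration.integral_cong)
    fix \<omega> assume "\<omega> \<in> space M"
    then show "real_of_int (eps 0 \<omega>) = 2 * indicator {\<omega> \<in> space M. eps 0 \<omega> = 1} \<omega> - 1"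
      using eps_cases[of \<omega> 0] by auto
  qed simp
  also have "\<dots> = 2 * measure M {\<omega> \<in> space M. eps 0 \<omega> = 1} - 1"
  proof -
    have "{\<omega> \<in> space M. eps 0 \<omega> = 1} \<in> sets M" by measurable
    moreover from this have "integrable M (indicat_real {\<omega> \<in> space M. eps 0 \<omega> = 1})"
      by (intro integrable_real_indicator) (auto simp: emeasure_eq_measure)
    ultimately show ?thesis by (subst Bochner_Integration.integral_diff) (auto simp: prob_space)
  qed
  also have "\<dots> = 0" using orientation by (simp add: orientation_assumptions_def)
  finally show ?thesis .
qed

definition corr :: "nat \<Rightarrow> real" where
  "corr d = (\<integral>\<omega>. real_of_int (eps 0 \<omega> * eps (int d) \<omega>) \<partial>M)"

lemma eps_corr: "(\<integral>\<omega>. real_of_int (eps y \<omega> * eps z \<omega>) \<partial>M) = corr (nat \<bar>y - z\<bar>)"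
proof -
  have *: "(\<integral>\<omega>. real_of_int (eps y \<omega> * eps z \<omega>) \<partial>M) = corr (nat (z - y))" if "y \<le> z" for y z
    using shift_invariant_integral[of "\<lambda>e. real_of_int (e 0 * e (z - y))" y] that
    by (simp add: corr_def)
  show ?thesis
    using *[of y z] *[of z y] by (cases "y \<le> z") (simp_all add: mult.commute)
qed

lemma corr_0 [simp]: "corr 0 = 1"
proof -
  have "corr 0 = (\<integral>\<omega>. 1 \<partial>M)"
    unfolding corr_def
  proof (rule Bochner_Integration.integral_cong)
    fix \<omega> assume "\<omega> \<in> space M"
    then show "real_of_int (eps 0 \<omega> * eps (int 0) \<omega>) = 1" using eps_cases[of \<omega> 0] by auto
  qed simp
  then show ?thesis by (simp add: prob_space)
qed

lemma cexp_coord: "y \<in> J \<Longrightarrow> cexp J (\<lambda>x. real_of_int (x y)) = 0"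
  by (simp add: cexp_def cfg_def eps_mean)

lemma cexp_coord_mult: "y \<in> J \<Longrightarrow> z \<in> J \<Longrightarrow> cexp J (\<lambda>x. real_of_int (x y) * real_of_int (x z)) = corr (nat \<bar>y - z\<bar>)"
  by (simp add: cexp_def cfg_def eps_corr[symmetric])

text \<open>Coordinates are nondecreasing and centred. Positivity is used both to enlarge the
  weights in the Newman error and to drop off-diagonal terms of the block variance.\<close>

lemma corr_nonneg: "0 \<le> corr d"
proof -
  have "0 \<le> cexp {0, int d} (\<lambda>x. real_of_int (x 0) * real_of_int (x (int d)))
      - cexp {0, int d} (\<lambda>x. real_of_int (x 0)) * cexp {0, int d} (\<lambda>x. real_of_int (x (int d)))"
    by (rule association) auto
  then show ?thesis by (simp add: cexp_coord cexp_coord_mult)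
qed

lemma corr_le_1: "corr d \<le> 1"
proof -
  have "cexp {0, int d} (\<lambda>x. real_of_int (x 0) * real_of_int (x (int d))) \<le> cexp {0, int d} (\<lambda>x. 1)"
  proof (rule cexp_mono)
    fix x :: "int \<Rightarrow> int" assume "x \<in> {0, int d} \<rightarrow>\<^sub>E {-1, 1}"
    then have "x 0 \<in> {-1, 1}" "x (int d) \<in> {-1, 1}" by auto
    then show "real_of_int (x 0) * real_of_int (x (int d)) \<le> 1" by auto
  qed simp
  then show ?thesis by (simp add: cexp_const cexp_coord_mult)
qed

text \<open>Half of the excess of the exponent over 1 is called \<open>\<theta>\<close>: one
  \<open>\<theta>\<close> will buy summability, the other a gain per block. The distances below
  \<open>N\<close> are absorbed into \<open>C1\<close> using \<open>corr d \<le> 1\<close>.\<close>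

lemma corr_decay:
  obtains \<theta> C1 where "0 < \<theta>" "\<theta> \<le> 1 / 2" "C1 \<ge> 0"
    "\<And>d. d \<ge> 1 \<Longrightarrow> corr d \<le> C1 * real d powr (- (1 + 2 * \<theta>))"
proof -
  have "\<exists>\<alpha>>1. \<exists>C N. \<forall>y::int. \<bar>y\<bar> \<ge> N \<longrightarrow>
        \<bar>\<integral>\<omega>. real_of_int (eps 0 \<omega> * eps y \<omega>) \<partial>M\<bar> \<le> C * real_of_int \<bar>y\<bar> powr (-\<alpha>)"
    using orientation unfolding orientation_assumptions_def by (elim conjE)
  then obtain \<alpha> C N where \<alpha>: "\<alpha> > 1" and dec:
    "\<And>y::int. \<bar>y\<bar> \<ge> N \<Longrightarrow> \<bar>\<integral>\<omega>. real_of_int (eps 0 \<omega> * eps y \<omega>) \<partial>M\<bar> \<le> C * real_of_int \<bar>y\<bar> powr (-\<alpha>)"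
    by metis
  define \<theta> where "\<theta> = min ((\<alpha> - 1) / 2) (1 / 2)"
  define p where "p = 1 + 2 * \<theta>"
  define C1 where "C1 = \<bar>C\<bar> + real_of_int \<bar>N\<bar> powr p"
  have \<theta>: "0 < \<theta>" "\<theta> \<le> 1 / 2" "p \<le> \<alpha>" "p > 0" using \<alpha> by (auto simp: \<theta>_def p_def min_def field_simps)
  have "corr d \<le> C1 * real d powr (- p)" if d: "d \<ge> 1" for d
  proof (cases "int d \<ge> N")
    case True
    have "corr d \<le> C * real d powr (- \<alpha>)" using dec[of "int d"] True by (simp add: corr_def)
    also have "\<dots> \<le> \<bar>C\<bar> * real d powr (- \<alpha>)" by (intro mult_right_mono) auto
    also have "\<dots> \<le> \<bar>C\<bar> * real d powr (- p)" using \<theta> d by (intro mult_left_mono powr_mono) auto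
    also have "\<dots> \<le> C1 * real d powr (- p)" by (intro mult_right_mono) (auto simp: C1_def)
    finally show ?thesis .
  next
    case False
    have "1 = real d powr p * real d powr (- p)" using d by (simp add: powr_add[symmetric])
    also have "\<dots> \<le> real_of_int \<bar>N\<bar> powr p * real d powr (- p)"
      using False \<theta> by (intro mult_right_mono powr_mono2) auto
    also have "\<dots> \<le> C1 * real d powr (- p)" by (intro mult_right_mono) (auto simp: C1_def)
    finally show ?thesis using corr_le_1[of d] by linarith
  qed
  moreover have "C1 \<ge> 0" by (simp add: C1_def)
  ultimately show ?thesis using that[of \<theta> C1] \<theta> by (simp add: p_def)
qed

section \<open>Linear forms and their block decomposition\<close>

definition lin :: "int \<Rightarrow> (nat \<Rightarrow> real) \<Rightarrow> nat set \<Rightarrow> (int \<Rightarrow> int) \<Rightarrow> real" where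
  "lin s0 w I x = (\<Sum>i\<in>I. w i * real_of_int (x (s0 + int i)))"

lemma lin_mono:
  assumes "\<And>i. i \<in> I \<Longrightarrow> 0 \<le> w i" "\<And>i. i \<in> I \<Longrightarrow> s0 + int i \<in> J" "\<And>y. y \<in> J \<Longrightarrow> x y \<le> x' y"
  shows "lin s0 w I x \<le> lin s0 w I x'"
  unfolding lin_def using assms by (intro sum_mono mult_left_mono) auto

lemma cexp_lin:
  assumes "finite J" "\<And>i. i \<in> I \<Longrightarrow> s0 + int i \<in> J"
  shows "cexp J (lin s0 w I) = 0"
proof -
  have "cexp J (lin s0 w I) = (\<Sum>i\<in>I. w i * cexp J (\<lambda>x. real_of_int (x (s0 + int i))))"
    unfolding lin_def cexp_sum[OF assms(1)] cexp_cmult ..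
  then show ?thesis using assms by (simp add: cexp_coord)
qed

lemma cexp_lin_mult:
  assumes "finite J" "\<And>i. i \<in> I \<Longrightarrow> s0 + int i \<in> J" "\<And>i. i \<in> I' \<Longrightarrow> s0 + int i \<in> J"
  shows "cexp J (\<lambda>x. lin s0 w I x * lin s0 w I' x) = (\<Sum>i\<in>I. \<Sum>l\<in>I'. w i * w l * corr (nat \<bar>int i - int l\<bar>))"
proof -
  have "cexp J (\<lambda>x. lin s0 w I x * lin s0 w I' x)
     = (\<Sum>i\<in>I. \<Sum>l\<in>I'. cexp J (\<lambda>x. (w i * w l) * (real_of_int (x (s0 + int i)) * real_of_int (x (s0 + int l)))))"
    unfolding lin_def sum_product by (simp only: cexp_sum[OF assms(1)] mult_ac)
  then show ?thesis using assms by (simp add: cexp_cmult cexp_coord_mult)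
qed

lemma lin_split: "lin s0 w {..<(Suc b) * L} x = lin s0 w {..<b * L} x + lin s0 w {b * L..<Suc b * L} x"
proof -
  have u: "{..<Suc b * L} = {..<b * L} \<union> {b * L..<Suc b * L}" by auto
  show ?thesis unfolding lin_def by (subst u, rule sum.union_disjoint) auto
qed

lemma abs_lin_le:
  assumes "x \<in> J \<rightarrow>\<^sub>E {-1, 1}" "\<And>i. i \<in> I \<Longrightarrow> s0 + int i \<in> J" "\<And>i. i \<in> I \<Longrightarrow> 0 \<le> w i \<and> w i \<le> K"
  shows "\<bar>lin s0 w I x\<bar> \<le> real (card I) * K"
proof -
  have "\<bar>lin s0 w I x\<bar> \<le> (\<Sum>i\<in>I. \<bar>w i * real_of_int (x (s0 + int i))\<bar>)"
    unfolding lin_def by (rule sum_abs)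
  also have "\<dots> \<le> (\<Sum>i\<in>I. K)"
  proof (rule sum_mono)
    fix i assume i: "i \<in> I"
    then have "x (s0 + int i) \<in> {-1, 1}" using assms(1) assms(2)[OF i] by (auto simp: PiE_iff)
    then show "\<bar>w i * real_of_int (x (s0 + int i))\<bar> \<le> K" using assms(3)[OF i] by (auto simp: abs_mult)
  qed
  finally show ?thesis by simp
qed

text \<open>Induction on the number of blocks. Newman's inequality detaches the last block, with an
  error given by its correlation with the past; inside the block \<open>t * L * K \<le> 1\<close>
  permits the small-argument estimate. The exponential factors multiply.\<close>

lemma chf_blocks:
  fixes w :: "nat \<Rightarrow> real"
  assumes C2: "\<And>b L. (\<Sum>r<L. \<Sum>i<b * L. corr (b * L + r - i)) \<le> C2 * real L powr (1 - \<theta>)"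
    and t: "t \<ge> 0" and w: "\<And>i. 0 \<le> w i \<and> w i \<le> K" and tLK: "t * real L * K \<le> 1"
    and J: "J = (\<lambda>i. s0 + int i) ` {..<B * L}"
    and "b \<le> B"
  shows "cmod (chf J (\<lambda>x. t * lin s0 w {..<b * L} x))
    \<le> exp (- (t\<^sup>2 * (\<Sum>i<b * L. (w i)\<^sup>2) / 6)) + real b * (4 * t\<^sup>2 * K\<^sup>2 * (C2 * real L powr (1 - \<theta>)))"
  using \<open>b \<le> B\<close>
proof (induction b)
  case 0
  have "cmod (chf J (\<lambda>x. 0)) \<le> 1" unfolding chf_def by (simp add: cexp_const cmod_def)
  then show ?case by (simp add: lin_def)
next
  case (Suc b)
  have fJ: "finite J" by (simp add: J)
  have le: "b * L \<le> B * L" "Suc b * L \<le> B * L" using Suc.prems mult_le_mono1[of "Suc b" B L] by auto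
  have in1: "s0 + int i \<in> J" if "i \<in> {..<b * L}" for i using that le by (auto simp: J)
  have in2: "s0 + int i \<in> J" if "i \<in> {b * L..<Suc b * L}" for i using that le(2) by (auto simp: J)
  define A where "A = {..<b * L}"
  define A' where "A' = {b * L..<Suc b * L}"
  let ?U = "\<lambda>x. t * lin s0 w A x" and ?V = "\<lambda>x. t * lin s0 w A' x"
  let ?Q = "\<lambda>I. \<Sum>i\<in>I. (w i)\<^sup>2"
  let ?err = "4 * t\<^sup>2 * K\<^sup>2 * (C2 * real L powr (1 - \<theta>))"
  have K0: "0 \<le> K" using w[of 0] by linarith
  have cov: "cexp J (\<lambda>x. ?U x * ?V x) - cexp J ?U * cexp J ?V \<le> t\<^sup>2 * (K\<^sup>2 * (C2 * real L powr (1 - \<theta>)))"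
  proof -
    have "cexp J (\<lambda>x. ?U x * ?V x) = cexp J (\<lambda>x. t\<^sup>2 * (lin s0 w A x * lin s0 w A' x))"
      by (simp add: power2_eq_square mult_ac)
    also have "\<dots> = t\<^sup>2 * (\<Sum>i\<in>A. \<Sum>l\<in>A'. w i * w l * corr (nat \<bar>int i - int l\<bar>))"
      unfolding cexp_cmult using cexp_lin_mult[OF fJ, of A s0 A' w] in1 in2 by (simp only: A_def A'_def)
    also have "(\<Sum>i\<in>A. \<Sum>l\<in>A'. w i * w l * corr (nat \<bar>int i - int l\<bar>)) \<le> (\<Sum>i\<in>A. \<Sum>l\<in>A'. K\<^sup>2 * corr (nat \<bar>int i - int l\<bar>))"
    proof (intro sum_mono mult_right_mono corr_nonneg)
      fix i l
      show "w i * w l \<le> K\<^sup>2" unfolding power2_eq_square by (rule mult_mono) (simp_all add: w K0)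
    qed
    also have "\<dots> = K\<^sup>2 * (\<Sum>l\<in>A'. \<Sum>i\<in>A. corr (nat \<bar>int i - int l\<bar>))"
      by (subst sum.swap) (simp add: sum_distrib_left)
    also have "(\<Sum>l\<in>A'. \<Sum>i\<in>A. corr (nat \<bar>int i - int l\<bar>)) = (\<Sum>r<L. \<Sum>i\<in>A. corr (nat \<bar>int i - int (b * L + r)\<bar>))"
      unfolding A'_def by (rule sum.reindex_bij_witness[of _ "\<lambda>r. b * L + r" "\<lambda>l. l - b * L"]) auto
    also have "\<dots> = (\<Sum>r<L. \<Sum>i<b * L. corr (b * L + r - i))"
      unfolding A_def
    proof (intro sum.cong refl)
      fix r i assume "i \<in> {..<b * L}"
      moreover have "nat \<bar>int i - int (n + r)\<bar> = n + r - i" if "i < n" for n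
        using that by linarith
      ultimately have "nat \<bar>int i - int (b * L + r)\<bar> = b * L + r - i" by blast
      then show "corr (nat \<bar>int i - int (b * L + r)\<bar>) = corr (b * L + r - i)" by simp
    qed
    also have "K\<^sup>2 * (\<Sum>r<L. \<Sum>i<b * L. corr (b * L + r - i)) \<le> K\<^sup>2 * (C2 * real L powr (1 - \<theta>))"
      by (intro mult_left_mono C2) auto
    finally have "cexp J (\<lambda>x. ?U x * ?V x) \<le> t\<^sup>2 * (K\<^sup>2 * (C2 * real L powr (1 - \<theta>)))"
      by (simp add: mult_left_mono)
    moreover have "cexp J (lin s0 w A) = 0" by (rule cexp_lin[OF fJ]) (use in1 in \<open>simp add: A_def\<close>)
    then have "cexp J ?U = 0" unfolding cexp_cmult by simp
    ultimately show ?thesis by simp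
  qed
  have mono: "?U x \<le> ?U x'" "?V x \<le> ?V x'"
    if "x \<in> J \<rightarrow>\<^sub>E {-1, 1}" "x' \<in> J \<rightarrow>\<^sub>E {-1, 1}" "\<And>y. y \<in> J \<Longrightarrow> x y \<le> x' y" for x x'
  proof -
    have "lin s0 w A x \<le> lin s0 w A x'" by (rule lin_mono[where J = J]) (use w in1 that(3) in \<open>simp_all add: A_def\<close>)
    then show "?U x \<le> ?U x'" by (rule mult_left_mono) (rule t)
    have "lin s0 w A' x \<le> lin s0 w A' x'" by (rule lin_mono[where J = J]) (use w in2 that(3) in \<open>simp_all add: A'_def\<close>)
    then show "?V x \<le> ?V x'" by (rule mult_left_mono) (rule t)
  qed
  have "cmod (chf J (\<lambda>x. ?U x + ?V x) - chf J ?U * chf J ?V) \<le> 4 * (t\<^sup>2 * (K\<^sup>2 * (C2 * real L powr (1 - \<theta>))))"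
  proof -
    have "cmod (chf J (\<lambda>x. ?U x + ?V x) - chf J ?U * chf J ?V)
        \<le> 4 * (cexp J (\<lambda>x. ?U x * ?V x) - cexp J ?U * cexp J ?V)"
      by (rule newman_inequality[OF fJ]) (rule mono; assumption)+
    also have "\<dots> \<le> 4 * (t\<^sup>2 * (K\<^sup>2 * (C2 * real L powr (1 - \<theta>))))"
      by (rule mult_left_mono[OF cov]) simp
    finally show ?thesis .
  qed
  then have nw: "cmod (chf J (\<lambda>x. ?U x + ?V x)) \<le> cmod (chf J ?U) * cmod (chf J ?V) + ?err"
    using norm_triangle_ineq2[of "chf J (\<lambda>x. ?U x + ?V x)" "chf J ?U * chf J ?V"]
    by (simp add: norm_mult algebra_simps)
  have V: "cmod (chf J ?V) \<le> exp (- (t\<^sup>2 * ?Q A' / 6))"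
  proof -
    have "cmod (chf J ?V) \<le> exp (- cexp J (\<lambda>x. (?V x)\<^sup>2) / 6)"
    proof (rule chf_small_argument[OF fJ])
      fix x assume x: "x \<in> J \<rightarrow>\<^sub>E {-1, 1 :: int}"
      have "\<bar>lin s0 w A' x\<bar> \<le> real (card A') * K" by (rule abs_lin_le[OF x]) (use in2 w in \<open>auto simp: A'_def\<close>)
      then have "t * \<bar>lin s0 w A' x\<bar> \<le> t * (real L * K)" using t by (intro mult_left_mono) (auto simp: A'_def)
      then show "\<bar>?V x\<bar> \<le> 1" using t tLK by (simp add: abs_mult mult.assoc)
    next
      have "cexp J (lin s0 w A') = 0" by (rule cexp_lin[OF fJ]) (use in2 in \<open>simp add: A'_def\<close>)
      then show "cexp J ?V = 0" unfolding cexp_cmult by simp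
    qed
    also have "cexp J (\<lambda>x. (?V x)\<^sup>2) \<ge> t\<^sup>2 * ?Q A'"
    proof -
      have "cexp J (\<lambda>x. (?V x)\<^sup>2) = cexp J (\<lambda>x. t\<^sup>2 * (lin s0 w A' x * lin s0 w A' x))"
        by (simp add: power2_eq_square mult_ac)
      also have "\<dots> = t\<^sup>2 * (\<Sum>i\<in>A'. \<Sum>l\<in>A'. w i * w l * corr (nat \<bar>int i - int l\<bar>))"
        unfolding cexp_cmult using cexp_lin_mult[OF fJ, of A' s0 A' w] in2 by (simp only: A'_def)
      \<comment> \<open>Positive correlations allow keeping only the diagonal, where
        \<open>corr 0 = 1\<close>.\<close>
      also have "\<dots> \<ge> t\<^sup>2 * ?Q A'"
      proof (intro mult_left_mono sum_mono)
        fix i assume i: "i \<in> A'"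
        have "w i * w i * corr (nat \<bar>int i - int i\<bar>) \<le> (\<Sum>l\<in>A'. w i * w l * corr (nat \<bar>int i - int l\<bar>))"
          using w corr_nonneg i by (intro member_le_sum) (auto simp: A'_def)
        then show "(w i)\<^sup>2 \<le> (\<Sum>l\<in>A'. w i * w l * corr (nat \<bar>int i - int l\<bar>))"
          by (simp add: power2_eq_square)
      qed auto
      finally show ?thesis .
    qed
    then have "exp (- cexp J (\<lambda>x. (?V x)\<^sup>2) / 6) \<le> exp (- (t\<^sup>2 * ?Q A' / 6))" by simp
    finally show ?thesis .
  qed
  have V1: "cmod (chf J ?V) \<le> 1"
  proof -
    have "exp (- (t\<^sup>2 * ?Q A' / 6)) \<le> 1" by (simp add: sum_nonneg)
    with V show ?thesis by linarith
  qed
  have IH: "cmod (chf J ?U) \<le> exp (- (t\<^sup>2 * ?Q A / 6)) + real b * ?err"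
    using Suc.IH Suc.prems by (simp add: A_def)
  have err0: "0 \<le> ?err"
  proof -
    \<comment> \<open>For zero preceding blocks the sum is empty, which shows that its upper bound
      is nonnegative.\<close>
    have "0 \<le> (\<Sum>r<L. \<Sum>i<0 * L. corr (0 * L + r - i))" by simp
    also have "\<dots> \<le> C2 * real L powr (1 - \<theta>)" by (rule C2)
    finally show ?thesis by simp
  qed
  \<comment> \<open>The error accumulated so far is multiplied by a factor of modulus at most 1, so
    errors only add up.\<close>
  have "cmod (chf J ?U) * cmod (chf J ?V) \<le> (exp (- (t\<^sup>2 * ?Q A / 6)) + real b * ?err) * cmod (chf J ?V)"
    by (intro mult_right_mono IH) auto
  also have "\<dots> = exp (- (t\<^sup>2 * ?Q A / 6)) * cmod (chf J ?V) + real b * ?err * cmod (chf J ?V)"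
    by (simp only: distrib_right)
  also have "\<dots> \<le> exp (- (t\<^sup>2 * ?Q A / 6)) * exp (- (t\<^sup>2 * ?Q A' / 6)) + real b * ?err * 1"
    using err0 by (intro add_mono mult_left_mono V V1) auto
  also have "exp (- (t\<^sup>2 * ?Q A / 6)) * exp (- (t\<^sup>2 * ?Q A' / 6)) = exp (- (t\<^sup>2 * ?Q {..<Suc b * L} / 6))"
  proof -
    have u: "{..<Suc b * L} = A \<union> A'" by (auto simp: A_def A'_def)
    have "?Q {..<Suc b * L} = ?Q A + ?Q A'"
      unfolding u by (rule sum.union_disjoint) (auto simp: A_def A'_def)
    moreover have "exp (- (t\<^sup>2 * p / 6)) * exp (- (t\<^sup>2 * q / 6)) = exp (- (t\<^sup>2 * (p + q) / 6))" for p q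
      unfolding exp_add[symmetric] by (simp add: distrib_left add_divide_distrib)
    ultimately show ?thesis by (simp only:)
  qed
  finally have pq: "cmod (chf J ?U) * cmod (chf J ?V) \<le> exp (- (t\<^sup>2 * ?Q {..<Suc b * L} / 6)) + real b * ?err * 1" .
  have "cmod (chf J (\<lambda>x. ?U x + ?V x)) \<le> exp (- (t\<^sup>2 * ?Q {..<Suc b * L} / 6)) + real b * ?err * 1 + ?err"
    by (rule order_trans[OF nw add_right_mono[OF pq]])
  also have "\<dots> = exp (- (t\<^sup>2 * ?Q {..<Suc b * L} / 6)) + real (Suc b) * ?err"
    by (simp only: of_nat_Suc distrib_right mult_1 mult_1_right add_ac)
  finally have "cmod (chf J (\<lambda>x. ?U x + ?V x)) \<le> exp (- (t\<^sup>2 * ?Q {..<Suc b * L} / 6)) + real (Suc b) * ?err" .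
  moreover have eq: "(\<lambda>x. ?U x + ?V x) = (\<lambda>x. t * lin s0 w {..<Suc b * L} x)"
    by (simp only: lin_split A_def A'_def distrib_left)
  ultimately show ?case unfolding eq by blast
qed

section \<open>From characteristic functions to small balls\<close>

lemma cos_ge_half: "\<bar>x\<bar> \<le> 1 \<Longrightarrow> 1 / 2 \<le> cos x" for x :: real
proof -
  assume "\<bar>x\<bar> \<le> 1"
  then have "\<bar>x\<bar> \<le> \<bar>pi / 3\<bar>" using pi_gt3 by simp
  then have "cos (pi / 3) \<le> cos \<bar>x\<bar>"
    using pi_gt3 by (intro cos_monotone_0_pi_le) auto
  then show ?thesis by (simp add: cos_60)
qed

text \<open>The squared modulus of the sum of \<open>exp (i j h S)\<close> over \<open>j < m\<close> is at least \<open>m\<^sup>2/4\<close> where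
  \<open>\<bar>S\<bar> \<le> \<rho>\<close>, and its expectation only involves the characteristic function at multiples of \<open>h\<close>.\<close>

lemma small_ball_chf:
  assumes J: "finite J" and m: "m \<ge> 1" and h: "h \<ge> 0" and mh: "real m * h * \<rho> \<le> 1"
    and ch: "\<And>d. 1 \<le> d \<Longrightarrow> d < m \<Longrightarrow> cmod (chf J (\<lambda>x. real d * h * S x)) \<le> \<eta>" and \<eta>: "\<eta> \<ge> 0"
  shows "cexp J (\<lambda>x. of_bool (\<bar>S x\<bar> \<le> \<rho>)) \<le> 4 * (1 / real m + \<eta>)"
proof -
  let ?F = "\<lambda>x. (\<Sum>j<m. \<Sum>l<m. cos ((real j - real l) * h * S x))"
  have pt: "of_bool (\<bar>S x\<bar> \<le> \<rho>) \<le> 4 / (real m)\<^sup>2 * ?F x" for x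
  proof -
    have eq: "?F x = (\<Sum>j<m. cos (real j * h * S x))\<^sup>2 + (\<Sum>j<m. sin (real j * h * S x))\<^sup>2"
      by (simp add: power2_eq_square sum_product sum.distrib[symmetric] left_diff_distrib cos_diff)
    have F0: "0 \<le> ?F x" unfolding eq by simp
    show ?thesis
    proof (cases "\<bar>S x\<bar> \<le> \<rho>")
      case True
      have "(\<Sum>j<m. 1 / 2) \<le> (\<Sum>j<m. cos (real j * h * S x))"
      proof (intro sum_mono cos_ge_half)
        fix j assume "j \<in> {..<m}"
        then have "real j * h * \<bar>S x\<bar> \<le> real m * h * \<rho>" using True h by (intro mult_mono) auto
        then show "\<bar>real j * h * S x\<bar> \<le> 1" using mh h by (simp add: abs_mult)
      qed
      then have "(real m / 2)\<^sup>2 \<le> (\<Sum>j<m. cos (real j * h * S x))\<^sup>2" by (intro power_mono) auto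
      also have "\<dots> \<le> ?F x" unfolding eq by simp
      finally show ?thesis using True m by (simp add: power_divide field_simps)
    qed (use F0 in simp)
  qed
  \<comment> \<open>Cosine is even, so only positive multiples of \<open>h\<close> occur. The
    \<open>m\<close> diagonal terms give \<open>1 / m\<close> after division by
    \<open>m^2\<close>.\<close>
  have cosd: "cexp J (\<lambda>x. cos ((real j - real l) * h * S x)) \<le> of_bool (j = l) + \<eta>" if "j < m" "l < m" for j l
  proof -
    have *: "cexp J (\<lambda>x. cos (real d * h * S x)) \<le> \<eta>" if "1 \<le> d" "d < m" for d
      using ch[OF that] abs_Re_le_cmod[of "chf J (\<lambda>x. real d * h * S x)"] by (simp add: chf_def)
    consider "j = l" | "j < l" | "l < j" by linarith
    then show ?thesis
    proof cases
      case 1 then show ?thesis using \<eta> by (simp add: cexp_const)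
    next
      case 2
      have "cos ((real j - real l) * h * S x) = cos (real (l - j) * h * S x)" for x
        using 2 cos_minus[of "real (l - j) * h * S x"] by (simp add: of_nat_diff algebra_simps)
      then show ?thesis using *[of "l - j"] 2 that by simp
    next
      case 3
      then show ?thesis using *[of "j - l"] that by (simp add: of_nat_diff)
    qed
  qed
  have "cexp J (\<lambda>x. of_bool (\<bar>S x\<bar> \<le> \<rho>)) \<le> cexp J (\<lambda>x. 4 / (real m)\<^sup>2 * ?F x)"
    by (intro cexp_mono J pt)
  also have "\<dots> = 4 / (real m)\<^sup>2 * (\<Sum>j<m. \<Sum>l<m. cexp J (\<lambda>x. cos ((real j - real l) * h * S x)))"
    unfolding cexp_cmult cexp_sum[OF J] ..
  also have "\<dots> \<le> 4 / (real m)\<^sup>2 * (\<Sum>j<m. \<Sum>l<m. of_bool (j = l) + \<eta>)"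
    by (intro mult_left_mono sum_mono cosd) auto
  also have "(\<Sum>j<m. \<Sum>l<m. of_bool (j = l) + \<eta>) = real m + (real m)\<^sup>2 * \<eta>"
    by (simp add: sum.distrib power2_eq_square of_bool_def distrib_left)
  also have "4 / (real m)\<^sup>2 * (real m + (real m)\<^sup>2 * \<eta>) = 4 * (1 / real m + \<eta>)"
  proof -
    have "(real m + (real m)\<^sup>2 * \<eta>) / (real m)\<^sup>2 = 1 / real m + \<eta>"
    proof -
      have "real m + (real m)\<^sup>2 * \<eta> = (1 / real m + \<eta>) * (real m)\<^sup>2"
      proof -
        have "1 / real m * real m = 1" using m by simp
        then show ?thesis unfolding power2_eq_square distrib_right mult.assoc[symmetric] by (simp add: mult_ac)
      qed
      then show ?thesis using m by simp
    qed
    moreover have "4 / (real m)\<^sup>2 * X = 4 * (X / (real m)\<^sup>2)" for X by simp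
    ultimately show ?thesis by (simp only:)
  qed
  finally show ?thesis .
qed

text \<open>The frequencies used are multiples of \<open>h\<close> in \<open>[h, m * h]\<close>. The
  Gaussian factor is worst at \<open>h\<close>, the Newman error at \<open>m * h\<close>, and the
  two are bounded separately.\<close>

theorem anticoncentration:
  obtains \<theta> C where "0 < \<theta>" "\<theta> \<le> 1 / 2" "C > 0"
    "\<And>s0 w B L m h K \<rho>. m \<ge> 1 \<Longrightarrow> h \<ge> 0 \<Longrightarrow> (\<And>i :: nat. 0 \<le> w i \<and> w i \<le> K) \<Longrightarrow>
      real m * h * real L * K \<le> 1 \<Longrightarrow> real m * h * \<rho> \<le> 1 \<Longrightarrow>
      measure M {\<omega> \<in> space M. \<bar>\<Sum>i<B * L. w i * real_of_int (eps (s0 + int i) \<omega>)\<bar> \<le> \<rho>}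
      \<le> 4 * (1 / real m + (exp (- (h\<^sup>2 * (\<Sum>i<B * L. (w i)\<^sup>2) / 6))
          + C * (real m * h)\<^sup>2 * K\<^sup>2 * real B * real L powr (1 - \<theta>)))"
proof -
  obtain \<theta> C1 where \<theta>: "0 < \<theta>" "\<theta> \<le> 1 / 2" and C1: "C1 \<ge> 0"
    and dec: "\<And>d. d \<ge> 1 \<Longrightarrow> corr d \<le> C1 * real d powr (- (1 + 2 * \<theta>))"
    by (rule corr_decay) blast
  obtain C2 where C2: "C2 > 0" "\<And>b L. (\<Sum>r<L. \<Sum>i<b * L. corr (b * L + r - i)) \<le> C2 * real L powr (1 - \<theta>)"
    using block_covariance_sum[OF \<theta> C1 dec] by blast
  show ?thesis
  proof (rule that[OF \<theta>, of "4 * C2"])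
    show "4 * C2 > 0" using C2 by simp
    fix s0 :: int and w :: "nat \<Rightarrow> real" and B L m :: nat and h K \<rho> :: real
    assume m: "m \<ge> 1" and h: "h \<ge> 0" and w: "\<And>i :: nat. 0 \<le> w i \<and> w i \<le> K"
      and mhLK: "real m * h * real L * K \<le> 1" and mhr: "real m * h * \<rho> \<le> 1"
    define J where "J = (\<lambda>i. s0 + int i) ` {..<B * L}"
    have fJ: "finite J" by (simp add: J_def)
    let ?S = "lin s0 w {..<B * L}"
    have S: "?S (cfg J \<omega>) = (\<Sum>i<B * L. w i * real_of_int (eps (s0 + int i) \<omega>))" for \<omega>
      unfolding lin_def cfg_def by (intro sum.cong) (auto simp: J_def)
    define \<eta> where "\<eta> = exp (- (h\<^sup>2 * (\<Sum>i<B * L. (w i)\<^sup>2) / 6))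
          + 4 * C2 * (real m * h)\<^sup>2 * K\<^sup>2 * real B * real L powr (1 - \<theta>)"
    have K0: "0 \<le> K" using w[of 0] by linarith
    have "cexp J (\<lambda>x. of_bool (\<bar>?S x\<bar> \<le> \<rho>)) \<le> 4 * (1 / real m + \<eta>)"
    proof (rule small_ball_chf[OF fJ m h mhr])
      show "\<eta> \<ge> 0" using C2 by (simp add: \<eta>_def)
      fix d :: nat assume d: "1 \<le> d" "d < m"
      define t where "t = real d * h"
      have t: "h \<le> t" "t \<le> real m * h" "0 \<le> t"
        using d h mult_right_mono[of 1 "real d" h] by (auto simp: t_def intro: mult_right_mono)
      have "t * real L * K \<le> real m * h * real L * K"
        using t K0 by (intro mult_right_mono) auto
      then have "cmod (chf J (\<lambda>x. t * ?S x))
        \<le> exp (- (t\<^sup>2 * (\<Sum>i<B * L. (w i)\<^sup>2) / 6)) + real B * (4 * t\<^sup>2 * K\<^sup>2 * (C2 * real L powr (1 - \<theta>)))"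
        using mhLK by (intro chf_blocks[OF C2(2) t(3) w _ J_def]) auto
      also have "\<dots> \<le> exp (- (h\<^sup>2 * (\<Sum>i<B * L. (w i)\<^sup>2) / 6)) + real B * (4 * (real m * h)\<^sup>2 * K\<^sup>2 * (C2 * real L powr (1 - \<theta>)))"
      proof (intro add_mono mult_left_mono mult_right_mono power_mono)
        have "h\<^sup>2 * (\<Sum>i<B * L. (w i)\<^sup>2) \<le> t\<^sup>2 * (\<Sum>i<B * L. (w i)\<^sup>2)"
          using t h by (intro mult_right_mono power_mono sum_nonneg) auto
        then show "exp (- (t\<^sup>2 * (\<Sum>i<B * L. (w i)\<^sup>2) / 6)) \<le> exp (- (h\<^sup>2 * (\<Sum>i<B * L. (w i)\<^sup>2) / 6))"
          by simp
      qed (use t C2 in auto)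
      also have "\<dots> = \<eta>" by (simp add: \<eta>_def)
      finally show "cmod (chf J (\<lambda>x. real d * h * ?S x)) \<le> \<eta>" by (simp add: t_def)
    qed
    also have "cexp J (\<lambda>x. of_bool (\<bar>?S x\<bar> \<le> \<rho>)) = measure M {\<omega> \<in> space M. \<bar>?S (cfg J \<omega>)\<bar> \<le> \<rho>}"
    proof -
      have "{\<omega> \<in> space M. \<bar>?S (cfg J \<omega>)\<bar> \<le> \<rho>} \<in> sets M" unfolding S by measurable
      then have "measure M {\<omega> \<in> space M. \<bar>?S (cfg J \<omega>)\<bar> \<le> \<rho>} = (\<integral>\<omega>. indicator {\<omega> \<in> space M. \<bar>?S (cfg J \<omega>)\<bar> \<le> \<rho>} \<omega> \<partial>M)"
        by (simp add: Int_absorb1 subset_iff)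
      also have "\<dots> = cexp J (\<lambda>x. of_bool (\<bar>?S x\<bar> \<le> \<rho>))"
        unfolding cexp_def by (intro Bochner_Integration.integral_cong) (auto simp: indicator_def)
      finally show ?thesis ..
    qed
    finally show "measure M {\<omega> \<in> space M. \<bar>\<Sum>i<B * L. w i * real_of_int (eps (s0 + int i) \<omega>)\<bar> \<le> \<rho>}
      \<le> 4 * (1 / real m + (exp (- (h\<^sup>2 * (\<Sum>i<B * L. (w i)\<^sup>2) / 6))
          + 4 * C2 * (real m * h)\<^sup>2 * K\<^sup>2 * real B * real L powr (1 - \<theta>)))"
      unfolding S \<eta>_def .
  qed
qed

end

section \<open>Typical words\<close>

text \<open>Inverting the quadratic Taylor lower bound of the exponential gives
  \<open>exp (- x) \<le> 1 - x + x^2\<close>; with the upper bound for \<open>exp x\<close> this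
  yields \<open>cosh x \<le> 1 + x^2\<close>.\<close>

lemma cosh_le_exp_square:
  fixes x :: real
  assumes "\<bar>x\<bar> \<le> 1"
  shows "cosh x \<le> exp (x\<^sup>2)"
proof -
  have *: "cosh x \<le> exp (x\<^sup>2)" if x: "0 \<le> x" "x \<le> 1" for x :: real
  proof -
    have "1 \<le> (1 - x + x\<^sup>2) * (1 + x + x\<^sup>2 / 2)"
    proof -
      have "(1 - x + x\<^sup>2) * (1 + x + x\<^sup>2 / 2) = 1 + (x\<^sup>2 / 2 + x ^ 3 / 2 + x ^ 4 / 2)"
        by (simp add: field_simps power2_eq_square power3_eq_cube power4_eq_xxxx)
      then show ?thesis using x by simp
    qed
    also have "\<dots> \<le> (1 - x + x\<^sup>2) * exp x"
      using x exp_lower_Taylor_quadratic[of x] by (intro mult_left_mono) auto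
    finally have "exp (- x) \<le> 1 - x + x\<^sup>2" by (simp add: exp_minus field_simps)
    moreover have "exp x \<le> 1 + x + x\<^sup>2" using x by (intro exp_bound)
    ultimately have "cosh x \<le> 1 + x\<^sup>2" by (simp add: cosh_field_def)
    also have "\<dots> \<le> exp (x\<^sup>2)" by (rule exp_ge_add_one_self)
    finally show ?thesis .
  qed
  show ?thesis using *[of x] *[of "- x"] assms by (cases "x \<ge> 0") auto
qed

lemma cosh_power_inverse_sqrt:
  assumes "N \<ge> 1"
  shows "cosh (1 / sqrt (real N)) ^ (j * N) \<le> exp (real j)"
proof -
  have "cosh (1 / sqrt (real N)) ^ (j * N) \<le> exp ((1 / sqrt (real N))\<^sup>2) ^ (j * N)"
    using assms by (intro power_mono cosh_le_exp_square) auto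
  also have "\<dots> = exp (real j)"
    using assms by (simp add: exp_of_nat_mult[symmetric] power_divide)
  finally show ?thesis .
qed

text \<open>The exponential bound at the diffusive scale, \<open>\<theta> = 1 / sqrt N\<close> with
  the sign of \<open>s\<close>; then \<open>cosh \<theta> ^ k\<close> costs at most
  \<open>exp 1\<close>.\<close>

lemma srw_tail:
  assumes "k \<le> N" "N \<ge> 1"
  shows "srw k s \<le> exp 1 * exp (- (\<bar>real_of_int s\<bar> / sqrt (real N)))"
proof -
  have *: "srw k s \<le> exp (- \<theta> * real_of_int s) * exp 1" if \<theta>: "\<bar>\<theta>\<bar> = 1 / sqrt (real N)" for \<theta>
  proof -
    have "cosh \<theta> ^ k = cosh \<bar>\<theta>\<bar> ^ k" by simp
    also have "\<dots> \<le> cosh \<bar>\<theta>\<bar> ^ (1 * N)" using assms by (intro power_increasing cosh_real_ge_1) auto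
    also have "\<dots> \<le> exp (real 1)" unfolding \<theta> by (rule cosh_power_inverse_sqrt[OF assms(2)])
    finally have "cosh \<theta> ^ k \<le> exp 1" by simp
    then have "exp (- \<theta> * real_of_int s) * cosh \<theta> ^ k \<le> exp (- \<theta> * real_of_int s) * exp 1"
      by (intro mult_left_mono) auto
    with srw_exp_bound[of k s \<theta>] show ?thesis by linarith
  qed
  show ?thesis
  proof (cases "s \<ge> 0")
    case True
    then show ?thesis using *[of "1 / sqrt (real N)"] by (simp add: mult.commute)
  next
    case False
    then show ?thesis using *[of "- (1 / sqrt (real N))"] by (simp add: mult.commute)
  qed
qed

text \<open>The first clause serves twice: it spreads the simple random walk of the merged pairs,
  and it makes the total number of row visits at least \<open>N / 8\<close>. The other two bound the
  size and the range of the coefficients.\<close>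

definition typical_word :: "real \<Rightarrow> nat \<Rightarrow> (nat \<times> nat) list \<Rightarrow> bool" where
  "typical_word \<delta> N c \<longleftrightarrow> N < 8 * n_merged c \<and> (\<forall>z. real (row_visits c 0 z) \<le> real N powr (1/2 + \<delta>)) \<and>
     (\<forall>z. row_visits c 0 z \<noteq> 0 \<longrightarrow> real_of_int \<bar>z\<bar> \<le> real N powr (1/2 + \<delta>))"

text \<open>\<open>pavg_exit\<close> with \<open>\<theta> = 1 / sqrt N\<close>. The hyperbolic
  cosines cost \<open>exp 2\<close>; rounding and the overshoot by one row together cost at most
  another \<open>exp 2\<close>.\<close>

lemma pavg_exit_scaled:
  assumes s: "s \<in> {-1, 1 :: int}" and N: "N \<ge> 1"
  shows "pavg N (\<lambda>c. of_bool (\<exists>z. real_of_int (s * z) > real N powr (1/2 + \<delta>) \<and> row_visits c 0 z \<noteq> 0))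
    \<le> exp 4 * exp (- (real N powr \<delta>))"
proof -
  let ?X = "real N powr (1/2 + \<delta>)" and ?\<theta> = "1 / sqrt (real N)"
  have X: "?X = sqrt (real N) * real N powr \<delta>" by (simp add: powr_add powr_half_sqrt)
  have "pavg N (\<lambda>c. of_bool (\<exists>z. real_of_int (s * z) > ?X \<and> row_visits c 0 z \<noteq> 0))
    \<le> pavg N (\<lambda>c. of_bool (\<exists>z. s * z > \<lfloor>?X\<rfloor> \<and> row_visits c 0 z \<noteq> 0))"
    by (intro pavg_mono) (auto simp: floor_less_iff)
  also have "\<dots> \<le> exp (?\<theta> * real_of_int (s * 0 + 1 - \<lfloor>?X\<rfloor>)) * cosh ?\<theta> ^ (2 * N)"
    by (rule pavg_exit[OF s]) simp
  also have "\<dots> \<le> exp (2 - real N powr \<delta>) * exp (real 2)"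
  proof (intro mult_mono cosh_power_inverse_sqrt[OF N])
    have "?\<theta> * real_of_int (s * 0 + 1 - \<lfloor>?X\<rfloor>) \<le> ?\<theta> * (2 - ?X)"
      by (intro mult_left_mono) (simp, linarith, simp)
    also have "\<dots> = 2 * ?\<theta> - real N powr \<delta>" unfolding X using N by (simp add: field_simps)
    also have "\<dots> \<le> 2 - real N powr \<delta>"
    proof -
      have "1 \<le> sqrt (real N)" using N by simp
      then have "?\<theta> \<le> 1" by (simp add: divide_le_eq)
      then show ?thesis by linarith
    qed
    finally show "exp (?\<theta> * real_of_int (s * 0 + 1 - \<lfloor>?X\<rfloor>)) \<le> exp (2 - real N powr \<delta>)" by simp
  qed auto
  also have "\<dots> = exp 4 * exp (- (real N powr \<delta>))" by (simp add: exp_add[symmetric])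
  finally show ?thesis .
qed

text \<open>A union bound: too few merges, exit above, exit below, or too many visits to some
  row.\<close>

lemma pavg_bad:
  assumes \<delta>: "\<delta> > 0" and N: "N \<ge> 1"
  shows "pavg N (\<lambda>c. of_bool (end_row c 0 = 0 \<and> \<not> typical_word \<delta> N c))
    \<le> (98 / 100) ^ N + 2 * exp 4 * exp (- (real N powr \<delta>))
      + (2 * real N powr (1/2 + \<delta>) + 1) * (exp 2 * exp (- (1/2 * real N powr \<delta>)))"
proof -
  let ?X = "real N powr (1/2 + \<delta>)" and ?\<theta> = "1 / sqrt (real N)"
  have X: "?X = sqrt (real N) * real N powr \<delta>" by (simp add: powr_add powr_half_sqrt)
  define Z where "Z = {- \<lfloor>?X\<rfloor>..\<lfloor>?X\<rfloor>}"
  define ex where "ex = (\<lambda>(s::int) c. \<exists>z. real_of_int (s * z) > ?X \<and> row_visits c 0 z \<noteq> 0)"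
  let ?F = "\<lambda>c. of_bool (8 * n_merged c \<le> N) + (of_bool (ex 1 c) + of_bool (ex (-1) c))
      + (\<Sum>z\<in>Z. of_bool (end_row c 0 = 0 \<and> real (row_visits c 0 z) > ?X)) :: real"
  have "pavg N (\<lambda>c. of_bool (end_row c 0 = 0 \<and> \<not> typical_word \<delta> N c)) \<le> pavg N ?F"
  proof (rule pavg_mono)
    fix c
    have nn: "0 \<le> (\<Sum>z\<in>Z. of_bool (end_row c 0 = 0 \<and> real (row_visits c 0 z) > ?X) :: real)" by (intro sum_nonneg) auto
    show "of_bool (end_row c 0 = 0 \<and> \<not> typical_word \<delta> N c) \<le> ?F c"
    proof (cases "end_row c 0 = 0 \<and> \<not> typical_word \<delta> N c \<and> \<not> 8 * n_merged c \<le> N \<and> \<not> ex 1 c \<and> \<not> ex (-1) c")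
      case True
      \<comment> \<open>Without an exit only rows in \<open>Z\<close> are visited, so the last union
        runs over at most \<open>2 * N powr (1/2 + \<delta>) + 1\<close> rows.\<close>
      have far: "\<bar>real_of_int z\<bar> \<le> ?X" if "row_visits c 0 z \<noteq> 0" for z
        using True that by (auto simp: ex_def abs_le_iff not_less)
      then obtain z where z: "real (row_visits c 0 z) > ?X" using True by (auto simp: typical_word_def not_le)
      then have "row_visits c 0 z \<noteq> 0" using powr_ge_zero[of "real N" "1/2 + \<delta>"] by (intro notI) simp
      then have "z \<in> Z" using far[of z] by (auto simp: Z_def le_floor_iff abs_le_iff minus_le_iff)
      then have "of_bool (end_row c 0 = 0 \<and> real (row_visits c 0 z) > ?X)
          \<le> (\<Sum>z\<in>Z. of_bool (end_row c 0 = 0 \<and> real (row_visits c 0 z) > ?X) :: real)"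
        by (intro member_le_sum) (auto simp: Z_def)
      then show ?thesis using z True by simp
    next
      case False
      then show ?thesis using nn by auto
    qed
  qed
  also have "\<dots> = pavg N (\<lambda>c. of_bool (8 * n_merged c \<le> N)) + (pavg N (\<lambda>c. of_bool (ex 1 c)) + pavg N (\<lambda>c. of_bool (ex (-1) c)))
      + (\<Sum>z\<in>Z. pavg N (\<lambda>c. of_bool (end_row c 0 = 0 \<and> real (row_visits c 0 z) > ?X)))"
    by (simp only: pavg_add pavg_sum)
  also have "\<dots> \<le> (98 / 100) ^ N + (exp 4 * exp (- (real N powr \<delta>)) + exp 4 * exp (- (real N powr \<delta>)))
      + (\<Sum>z\<in>Z. exp 2 * exp (- (1/2 * real N powr \<delta>)))"
  proof (intro add_mono sum_mono pavg_n_merged_small)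
    show "pavg N (\<lambda>c. of_bool (ex 1 c)) \<le> exp 4 * exp (- (real N powr \<delta>))"
      "pavg N (\<lambda>c. of_bool (ex (-1) c)) \<le> exp 4 * exp (- (real N powr \<delta>))"
      unfolding ex_def by (rule pavg_exit_scaled[OF _ N]; simp)+
    fix z
    have "pavg N (\<lambda>c. of_bool (end_row c 0 = 0 \<and> real (row_visits c 0 z) > ?X)) \<le> exp (- (?\<theta> / 2 * ?X)) * cosh ?\<theta> ^ (2 * N)"
      by (rule pavg_visits_tail) simp
    also have "\<dots> \<le> exp (- (?\<theta> / 2 * ?X)) * exp (real 2)"
      by (intro mult_left_mono cosh_power_inverse_sqrt[OF N]) auto
    also have "?\<theta> / 2 * ?X = 1/2 * real N powr \<delta>" unfolding X using N by simp
    finally show "pavg N (\<lambda>c. of_bool (end_row c 0 = 0 \<and> real (row_visits c 0 z) > ?X)) \<le> exp 2 * exp (- (1/2 * real N powr \<delta>))"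
      by (simp add: mult.commute)
  qed
  also have "(\<Sum>z\<in>Z. exp 2 * exp (- (1/2 * real N powr \<delta>))) \<le> (2 * ?X + 1) * (exp 2 * exp (- (1/2 * real N powr \<delta>)))"
  proof -
    have "real (card Z) = real_of_int (2 * \<lfloor>?X\<rfloor> + 1)" by (simp add: Z_def)
    also have "\<dots> \<le> 2 * ?X + 1" by simp
    finally show ?thesis by (simp add: mult_right_mono)
  qed
  finally show ?thesis by simp
qed

section \<open>Small balls at the scale of typical words\<close>

context fkg_orientation
begin

text \<open>Anticoncentration with blocks of length \<open>N^(1/8)\<close>, \<open>m\<close> of
  order \<open>N^\<delta>\<close> and \<open>h = N^(-3/4 + \<delta>)\<close>. The number
  \<open>n\<close> of terms is left open because it must be a multiple of the block length;
  \<open>w\<close> is therefore bounded at every index.\<close>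

lemma scaled_small_ball:
  obtains \<delta> C where "0 < \<delta>" "\<delta> \<le> 1 / 128" "C > 0"
    "eventually (\<lambda>N. \<forall>s0 A w. real A \<le> real N powr (1/2 + \<delta>) \<longrightarrow>
       (\<forall>i::nat. 0 \<le> w i \<and> w i \<le> real N powr (1/2 + \<delta>)) \<longrightarrow> real N / 8 \<le> (\<Sum>i<2 * A + 1. w i) \<longrightarrow>
       (\<exists>n\<ge>2 * A + 1. measure M {\<omega> \<in> space M. \<bar>\<Sum>i<n. w i * real_of_int (eps (s0 + int i) \<omega>)\<bar> \<le> real N powr (1/2 + \<delta>)}
          \<le> C * real N powr (- \<delta>))) sequentially"
proof -
  obtain \<theta> C where \<theta>: "0 < \<theta>" "\<theta> \<le> 1 / 2" and C: "C > 0" and ac: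
    "\<And>s0 w B L m h K \<rho>. m \<ge> 1 \<Longrightarrow> h \<ge> 0 \<Longrightarrow> (\<And>i :: nat. 0 \<le> w i \<and> w i \<le> K) \<Longrightarrow>
      real m * h * real L * K \<le> 1 \<Longrightarrow> real m * h * \<rho> \<le> 1 \<Longrightarrow>
      measure M {\<omega> \<in> space M. \<bar>\<Sum>i<B * L. w i * real_of_int (eps (s0 + int i) \<omega>)\<bar> \<le> \<rho>}
      \<le> 4 * (1 / real m + (exp (- (h\<^sup>2 * (\<Sum>i<B * L. (w i)\<^sup>2) / 6))
          + C * (real m * h)\<^sup>2 * K\<^sup>2 * real B * real L powr (1 - \<theta>)))"
    by (rule anticoncentration) blast
  \<comment> \<open>Blocks of length at least \<open>N^(1/8)\<close> gain
    \<open>N^(-\<theta>/8) = N^(-8\<delta>)\<close>. The remaining factors of the Newman error lose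
    \<open>N^(7\<delta>)\<close>, so \<open>N^(-\<delta>)\<close> survives.\<close>
  define \<delta> where "\<delta> = \<theta> / 64"
  have \<delta>: "0 < \<delta>" "\<delta> \<le> 1 / 128" using \<theta> by (auto simp: \<delta>_def)
  have ev1: "eventually (\<lambda>N::nat. 4 * real N powr (- 1 / 8 + 3 * \<delta>) \<le> 1) sequentially"
    using \<delta> by real_asymp
  have ev2: "eventually (\<lambda>N::nat. 2 * real N powr (- 1 / 4 + 3 * \<delta>) \<le> 1) sequentially"
    using \<delta> by real_asymp
  have ev3: "eventually (\<lambda>N::nat. exp (- (1 / 1920 * real N powr \<delta>)) \<le> real N powr (- \<delta>)) sequentially"
    using \<delta> by real_asymp
  show ?thesis
  proof (rule that[OF \<delta>, of "8 + 80 * C"])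
    show "8 + 80 * C > 0" using C by simp
    show "eventually (\<lambda>N. \<forall>s0 A w. real A \<le> real N powr (1/2 + \<delta>) \<longrightarrow>
       (\<forall>i::nat. 0 \<le> w i \<and> w i \<le> real N powr (1/2 + \<delta>)) \<longrightarrow> real N / 8 \<le> (\<Sum>i<2 * A + 1. w i) \<longrightarrow>
       (\<exists>n\<ge>2 * A + 1. measure M {\<omega> \<in> space M. \<bar>\<Sum>i<n. w i * real_of_int (eps (s0 + int i) \<omega>)\<bar> \<le> real N powr (1/2 + \<delta>)}
          \<le> (8 + 80 * C) * real N powr (- \<delta>))) sequentially"
      using ev1 ev2 ev3 eventually_ge_at_top[of 1]
    proof eventually_elim
      case (elim N)
      define P where "P a = real N powr a" for a
      have R: "real N \<ge> 1" using elim by simp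
      have P_mult: "P a * P b = P (a + b)" for a b by (simp add: P_def powr_add)
      have P_pos: "P a > 0" for a using R by (simp add: P_def)
      have P_mono: "P a \<le> P b" if "a \<le> b" for a b unfolding P_def using R that by (intro powr_mono) auto
      have P0: "P 0 = 1" using R by (simp add: P_def)
      have P1: "real N = P 1" using R by (simp add: P_def)
      have P_ge1: "1 \<le> P a" if "0 \<le> a" for a using P_mono[OF that] P0 by simp
      define X where "X = P (1/2 + \<delta>)"
      define L where "L = nat \<lceil>P (1/8)\<rceil>"
      define m where "m = nat \<lceil>P \<delta>\<rceil>"
      define h where "h = P (- 3/4 + \<delta>)"
      have ceil: "x \<le> real (nat \<lceil>x\<rceil>) \<and> real (nat \<lceil>x\<rceil>) \<le> 2 * x" if "1 \<le> x" for x :: real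
        using that by linarith
      have L: "P (1/8) \<le> real L" "real L \<le> 2 * P (1/8)" using ceil[OF P_ge1] by (auto simp: L_def)
      have m: "P \<delta> \<le> real m" "real m \<le> 2 * P \<delta>" using ceil[OF P_ge1] \<delta> by (auto simp: m_def)
      have L1: "real L \<ge> 1" "real m \<ge> 1" using L m P_ge1[of "1/8"] P_ge1[of \<delta>] \<delta> by linarith+
      have mh: "0 \<le> real m * h" "real m * h \<le> 2 * P (- 3/4 + 2 * \<delta>)"
      proof -
        show "0 \<le> real m * h" using P_pos[of "- 3/4 + \<delta>"] by (simp add: h_def)
        have "real m * h \<le> 2 * P \<delta> * h" using m P_pos[of "- 3/4 + \<delta>"] by (intro mult_right_mono) (auto simp: h_def)
        also have "\<dots> = 2 * P (- 3/4 + 2 * \<delta>)" by (simp add: h_def mult.assoc P_mult algebra_simps)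
        finally show "real m * h \<le> 2 * P (- 3/4 + 2 * \<delta>)" .
      qed
      have X0: "X > 0" by (simp add: X_def P_pos)
      have c1: "real m * h * real L * X \<le> 1"
      proof -
        have "real m * h * real L * X \<le> (2 * P (- 3/4 + 2 * \<delta>)) * (2 * P (1/8)) * X"
          by (rule mult_right_mono[OF mult_mono[OF mh(2) L(2)]]) (use X0 in \<open>simp_all add: less_imp_le[OF P_pos]\<close>)
        also have "\<dots> = 4 * ((P (- 3/4 + 2 * \<delta>) * P (1/8)) * P (1/2 + \<delta>))" by (simp add: X_def)
        also have "\<dots> = 4 * P (- 1/8 + 3 * \<delta>)" unfolding P_mult by (simp add: algebra_simps)
        finally show ?thesis using elim(1) by (simp add: P_def)
      qed
      have c2: "real m * h * X \<le> 1"
      proof -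
        have "real m * h * X \<le> (2 * P (- 3/4 + 2 * \<delta>)) * X"
          using mh X0 by (intro mult_right_mono) auto
        also have "\<dots> = 2 * (P (- 3/4 + 2 * \<delta>) * P (1/2 + \<delta>))" by (simp add: X_def)
        also have "\<dots> = 2 * P (- 1/4 + 3 * \<delta>)" unfolding P_mult by (simp add: algebra_simps)
        finally show ?thesis using elim(2) by (simp add: P_def)
      qed
      show ?case
      proof (intro allI impI)
        fix s0 :: int and A :: nat and w :: "nat \<Rightarrow> real"
        assume A: "real A \<le> real N powr (1/2 + \<delta>)"
          and w: "\<forall>i. 0 \<le> w i \<and> w i \<le> real N powr (1/2 + \<delta>)"
          and sw: "real N / 8 \<le> (\<Sum>i<2 * A + 1. w i)"
        \<comment> \<open>Enough blocks to cover all \<open>2 * A + 1\<close> sites, overshooting by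
          at most one block.\<close>
        define B where "B = (2 * A + 1) div L + 1"
        define n where "n = B * L"
        have L0: "L > 0" using L1 by simp
        have n: "2 * A + 1 \<le> n" "n \<le> 2 * A + 1 + L"
          using div_mult_mod_eq[of "2 * A + 1" L] mod_less_divisor[OF L0, of "2 * A + 1"]
          unfolding n_def B_def distrib_right by linarith+
        have n5: "real n \<le> 5 * X"
        proof -
          have "P (1/8) \<le> X" "1 \<le> X" unfolding X_def using \<delta> by (auto intro!: P_mono P_ge1)
          moreover have "real n \<le> 2 * real A + 1 + real L" using n(2) by linarith
          ultimately show ?thesis using A L unfolding X_def P_def by linarith
        qed
        define Q where "Q = (\<Sum>i<n. (w i)\<^sup>2)"
        have Q0: "Q \<ge> 0" by (auto simp: Q_def intro: sum_nonneg)
        \<comment> \<open>Cauchy-Schwarz: mass \<open>N / 8\<close> on at most \<open>5 * X\<close>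
          sites forces a large sum of squares.\<close>
        have "(P 1 / 8)\<^sup>2 \<le> Q * (5 * X)"
        proof -
          have "(\<Sum>i<2 * A + 1. w i) \<le> (\<Sum>i<n. w i)" using w n by (intro sum_mono2) auto
          then have "real N / 8 \<le> (\<Sum>i<n. w i)" using sw by linarith
          then have "(real N / 8)\<^sup>2 \<le> (\<Sum>i<n. w i)\<^sup>2" by (intro power_mono) auto
          also have "\<dots> \<le> Q * real n" using sum_squared_le_sum_of_squares[of w "{..<n}"] by (simp add: Q_def)
          also have "\<dots> \<le> Q * (5 * X)" using n5 Q0 by (intro mult_left_mono)
          finally show ?thesis unfolding P1 .
        qed
        then have "h\<^sup>2 * (P 1 / 8)\<^sup>2 * P (- (1/2 + \<delta>)) \<le> h\<^sup>2 * (Q * (5 * X)) * P (- (1/2 + \<delta>))"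
          by (intro mult_right_mono mult_left_mono less_imp_le[OF P_pos]) auto
        moreover have "h\<^sup>2 * (P 1 / 8)\<^sup>2 * P (- (1/2 + \<delta>)) = P \<delta> / 64"
        proof -
          have "h\<^sup>2 * (P 1 / 8)\<^sup>2 * P (- (1/2 + \<delta>)) = (h * h) * (P 1 * P 1) * P (- (1/2 + \<delta>)) / 64"
            by (simp add: power2_eq_square)
          also have "\<dots> = P \<delta> / 64" unfolding h_def P_mult by simp
          finally show ?thesis .
        qed
        moreover have "h\<^sup>2 * (Q * (5 * X)) * P (- (1/2 + \<delta>)) = 5 * (h\<^sup>2 * Q)"
        proof -
          have "h\<^sup>2 * (Q * (5 * X)) * P (- (1/2 + \<delta>)) = 5 * (h\<^sup>2 * Q) * (X * P (- (1/2 + \<delta>)))" by simp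
          also have "X * P (- (1/2 + \<delta>)) = 1" unfolding X_def P_mult using P0 by simp
          finally show ?thesis by simp
        qed
        ultimately have "1 / 1920 * P \<delta> \<le> h\<^sup>2 * Q / 6" by linarith
        then have "exp (- (h\<^sup>2 * Q / 6)) \<le> exp (- (1 / 1920 * P \<delta>))" by simp
        then have t1: "exp (- (h\<^sup>2 * Q / 6)) \<le> P (- \<delta>)" using elim(3) unfolding P_def by linarith
        have t2: "C * (real m * h)\<^sup>2 * X\<^sup>2 * real B * real L powr (1 - \<theta>) \<le> 20 * C * P (- \<delta>)"
        proof -
          have "real L powr (1 - \<theta>) = real L * real L powr (- \<theta>)"
            using L1 powr_add[of "real L" 1 "- \<theta>"] by simp
          then have "real B * real L powr (1 - \<theta>) = real n * real L powr (- \<theta>)" by (simp add: n_def)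
          also have "\<dots> \<le> (5 * X) * P (- 8 * \<delta>)"
          proof (intro mult_mono n5)
            have "real L powr (- \<theta>) \<le> P (1/8) powr (- \<theta>)"
              using \<theta> L P_pos[of "1/8"] by (intro powr_mono2') auto
            also have "\<dots> = P (- 8 * \<delta>)" by (simp add: P_def powr_powr \<delta>_def)
            finally show "real L powr (- \<theta>) \<le> P (- 8 * \<delta>)" .
          qed (use X0 in auto)
          finally have a: "real B * real L powr (1 - \<theta>) \<le> (5 * X) * P (- 8 * \<delta>)" .
          have b: "(real m * h)\<^sup>2 \<le> (2 * P (- 3/4 + 2 * \<delta>))\<^sup>2" using mh by (intro power_mono)
          have "C * (real m * h)\<^sup>2 * X\<^sup>2 * (real B * real L powr (1 - \<theta>))
              \<le> C * (2 * P (- 3/4 + 2 * \<delta>))\<^sup>2 * X\<^sup>2 * ((5 * X) * P (- 8 * \<delta>))"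
            using C by (intro mult_mono[OF _ a] mult_right_mono mult_left_mono b) auto
          also have "\<dots> = 20 * C * ((P (- 3/4 + 2 * \<delta>) * P (- 3/4 + 2 * \<delta>)) * (X * X) * X * P (- 8 * \<delta>))"
            by (simp add: power2_eq_square)
          also have "\<dots> = 20 * C * P (- \<delta>)" unfolding X_def P_mult by (simp add: algebra_simps)
          finally show ?thesis by (simp only: mult.assoc)
        qed
        have t3: "1 / real m \<le> P (- \<delta>)"
        proof -
          have "1 / real m \<le> 1 / P \<delta>" using m P_pos[of \<delta>] by (intro divide_left_mono) auto
          also have "\<dots> = P (- \<delta>)" by (simp add: P_def powr_minus divide_inverse)
          finally show ?thesis .
        qed
        have "measure M {\<omega> \<in> space M. \<bar>\<Sum>i<n. w i * real_of_int (eps (s0 + int i) \<omega>)\<bar> \<le> X}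
          \<le> 4 * (1 / real m + (exp (- (h\<^sup>2 * Q / 6)) + C * (real m * h)\<^sup>2 * X\<^sup>2 * real B * real L powr (1 - \<theta>)))"
          unfolding n_def Q_def
          by (rule ac) (use L1 P_pos[of "- 3/4 + \<delta>"] w c1 c2 in \<open>auto simp: h_def X_def P_def\<close>)
        also have "\<dots> \<le> 4 * (P (- \<delta>) + (P (- \<delta>) + 20 * C * P (- \<delta>)))"
          by (intro mult_left_mono add_mono t1 t2 t3) auto
        also have "\<dots> = (8 + 80 * C) * P (- \<delta>)" by (simp add: algebra_simps)
        finally show "\<exists>n\<ge>2 * A + 1. measure M {\<omega> \<in> space M. \<bar>\<Sum>i<n. w i * real_of_int (eps (s0 + int i) \<omega>)\<bar> \<le> real N powr (1/2 + \<delta>)}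
          \<le> (8 + 80 * C) * real N powr (- \<delta>)"
          using n(1) unfolding X_def P_def by blast
      qed
    qed
  qed
qed

lemma row_sum_measurable [measurable]: "(\<lambda>\<omega>. row_sum (\<lambda>y. eps y \<omega>) c y) \<in> measurable M (count_space UNIV)"
proof (induction c arbitrary: y)
  case (Cons p c)
  obtain i j where "p = (i, j)" by fastforce
  then show ?case using Cons[of "y + dy i + dy j"] by (cases "merged_pair i j") simp_all
qed simp

lemma srw_row_sum_integrable: "integrable M (\<lambda>\<omega>. srw k (row_sum (\<lambda>y. eps y \<omega>) c y))"
proof (rule integrable_const_bound[where B = "2 / sqrt (real k + 1)"])
  show "AE \<omega> in M. norm (srw k (row_sum (\<lambda>y. eps y \<omega>) c y)) \<le> 2 / sqrt (real k + 1)"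
    using srw_upper by simp
  show "(\<lambda>\<omega>. srw k (row_sum (\<lambda>y. eps y \<omega>) c y)) \<in> borel_measurable M"
    by (rule measurable_compose[OF row_sum_measurable]) simp
qed

lemma srw_row_sum_integral_le_2: "(\<integral>\<omega>. srw k (row_sum (\<lambda>y. eps y \<omega>) c y) \<partial>M) \<le> 2"
proof -
  have "srw k s \<le> 2" for s
  proof -
    have "2 / sqrt (real k + 1) \<le> 2 / 1" by (intro divide_left_mono) auto
    then show ?thesis using srw_upper[of k s] by linarith
  qed
  then have "(\<integral>\<omega>. srw k (row_sum (\<lambda>y. eps y \<omega>) c y) \<partial>M) \<le> (\<integral>\<omega>. 2 \<partial>M)"
    by (intro integral_mono srw_row_sum_integrable) auto
  then show ?thesis by (simp add: prob_space)
qed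

text \<open>Split according to whether the row sum is at most \<open>N^(1/2 + \<delta>)\<close> in
  modulus. If so, the local bound of order \<open>N^(-1/2)\<close> is multiplied by the small-ball
  probability; otherwise the tail of the simple random walk is negligible.\<close>

lemma typical_word_word_bound:
  obtains \<delta> C where "0 < \<delta>" "\<delta> \<le> 1 / 128" "C > 0"
    "eventually (\<lambda>N. \<forall>c\<in>pwords N. typical_word \<delta> N c \<longrightarrow>
       (\<integral>\<omega>. srw (n_merged c) (row_sum (\<lambda>y. eps y \<omega>) c 0) \<partial>M) \<le> C * real N powr (- (1/2 + \<delta>))) sequentially"
proof -
  obtain \<delta> C where \<delta>: "0 < \<delta>" "\<delta> \<le> 1 / 128" and C: "C > 0" and ev:
    "eventually (\<lambda>N. \<forall>s0 A w. real A \<le> real N powr (1/2 + \<delta>) \<longrightarrow>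
       (\<forall>i::nat. 0 \<le> w i \<and> w i \<le> real N powr (1/2 + \<delta>)) \<longrightarrow> real N / 8 \<le> (\<Sum>i<2 * A + 1. w i) \<longrightarrow>
       (\<exists>n\<ge>2 * A + 1. measure M {\<omega> \<in> space M. \<bar>\<Sum>i<n. w i * real_of_int (eps (s0 + int i) \<omega>)\<bar> \<le> real N powr (1/2 + \<delta>)}
          \<le> C * real N powr (- \<delta>))) sequentially"
    by (rule scaled_small_ball)
  have ev2: "eventually (\<lambda>N::nat. exp 1 * exp (- (real N powr \<delta>)) \<le> real N powr (- (1/2 + \<delta>))) sequentially"
    using \<delta> by real_asymp
  have "eventually (\<lambda>N. \<forall>c\<in>pwords N. typical_word \<delta> N c \<longrightarrow>
       (\<integral>\<omega>. srw (n_merged c) (row_sum (\<lambda>y. eps y \<omega>) c 0) \<partial>M) \<le> (6 * C + 1) * real N powr (- (1/2 + \<delta>))) sequentially"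
    using ev ev2 eventually_ge_at_top[of 1]
  proof eventually_elim
    case (elim N)
    show ?case
    proof (intro ballI impI)
      fix c assume c: "c \<in> pwords N" and g: "typical_word \<delta> N c"
      define X where "X = real N powr (1/2 + \<delta>)"
      define A where "A = nat \<lfloor>X\<rfloor>"
      \<comment> \<open>The rows from \<open>-A\<close> to \<open>A\<close> become the indices from
        0 to \<open>2 * A\<close>; by typicality no other row carries a coefficient.\<close>
      define s0 where "s0 = - int A"
      define w where "w i = real (row_visits c 0 (s0 + int i))" for i
      let ?S = "\<lambda>\<omega>. row_sum (\<lambda>y. eps y \<omega>) c 0"
      have N: "real N \<ge> 1" using elim by simp
      have X0: "X \<ge> 0" by (simp add: X_def)
      have A: "real A \<le> X" using X0 by (simp add: A_def)
      have sup: "{z. row_visits c 0 z \<noteq> 0} \<subseteq> (\<lambda>i. s0 + int i) ` {..<n}" if "n \<ge> 2 * A + 1" for n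
      proof
        fix z assume "z \<in> {z. row_visits c 0 z \<noteq> 0}"
        then have "real_of_int \<bar>z\<bar> \<le> X" using g by (simp add: typical_word_def X_def)
        then have "\<bar>z\<bar> \<le> int A" using X0 by (simp add: A_def le_floor_iff)
        then have "z = s0 + int (nat (z + int A))" "nat (z + int A) < n" using that by (auto simp: s0_def)
        then show "z \<in> (\<lambda>i. s0 + int i) ` {..<n}" by blast
      qed
      have inj: "inj_on (\<lambda>i. s0 + int i) I" for I by (auto simp: inj_on_def)
      have "n_merged c \<le> (\<Sum>z\<in>(\<lambda>i. s0 + int i) ` {..<2 * A + 1}. row_visits c 0 z)"
        by (rule n_merged_le_sum_row_visits) (use sup[of "2 * A + 1"] in auto)
      also have "\<dots> = (\<Sum>i<2 * A + 1. row_visits c 0 (s0 + int i))" by (subst sum.reindex[OF inj]) simp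
      finally have "real (n_merged c) \<le> (\<Sum>i<2 * A + 1. w i)"
        unfolding w_def by (metis of_nat_mono of_nat_sum)
      then have sw: "real N / 8 \<le> (\<Sum>i<2 * A + 1. w i)" using g by (simp add: typical_word_def)
      have w: "\<forall>i. 0 \<le> w i \<and> w i \<le> X" using g by (simp add: typical_word_def w_def X_def)
      obtain n where n: "n \<ge> 2 * A + 1" and
        pn: "measure M {\<omega> \<in> space M. \<bar>\<Sum>i<n. w i * real_of_int (eps (s0 + int i) \<omega>)\<bar> \<le> X} \<le> C * real N powr (- \<delta>)"
        using elim(1)[rule_format, of A w s0] A w sw unfolding X_def by blast
      have S: "real_of_int (?S \<omega>) = (\<Sum>i<n. w i * real_of_int (eps (s0 + int i) \<omega>))" for \<omega>
      proof -
        have "?S \<omega> = (\<Sum>z\<in>(\<lambda>i. s0 + int i) ` {..<n}. int (row_visits c 0 z) * eps z \<omega>)"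
          by (rule row_sum_eq_sum_row_visits) (use sup[OF n] in auto)
        also have "\<dots> = (\<Sum>i<n. int (row_visits c 0 (s0 + int i)) * eps (s0 + int i) \<omega>)"
          by (subst sum.reindex[OF inj]) simp
        finally show ?thesis by (simp add: w_def)
      qed
      define E where "E = {\<omega> \<in> space M. \<bar>real_of_int (?S \<omega>)\<bar> \<le> X}"
      have E: "E \<in> sets M" unfolding E_def by measurable
      have pE: "measure M E \<le> C * real N powr (- \<delta>)" using pn unfolding E_def S .
      have k: "n_merged c \<le> N" using n_merged_le_length[of c] c by (simp add: pwords_def)
      have pt: "srw (n_merged c) (?S \<omega>) \<le> 6 * real N powr (- (1/2)) * indicator E \<omega> + exp 1 * exp (- (real N powr \<delta>))"
        if "\<omega> \<in> space M" for \<omega>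
      proof (cases "\<omega> \<in> E")
        case True
        have "srw (n_merged c) (?S \<omega>) \<le> 2 / sqrt (real (n_merged c) + 1)" by (rule srw_upper)
        also have "\<dots> \<le> 2 / (sqrt (real N) / 3)"
        proof (intro divide_left_mono)
          have "sqrt (real N) / 3 = sqrt (real N / 9)" by (simp add: real_sqrt_divide)
          also have "\<dots> \<le> sqrt (real (n_merged c) + 1)" using g by (intro real_sqrt_le_mono) (simp add: typical_word_def)
          finally show "sqrt (real N) / 3 \<le> sqrt (real (n_merged c) + 1)" .
        qed (use N in auto)
        also have "\<dots> = 6 * real N powr (- (1/2))"
        proof -
          have "real N powr (- (1/2)) = 1 / sqrt (real N)"
            by (subst powr_minus_divide, subst powr_half_sqrt) auto
          then show ?thesis using N by simp
        qed
        finally show ?thesis using True by (simp add: add_increasing2)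
      next
        case False
        then have "X < \<bar>real_of_int (?S \<omega>)\<bar>" using that by (simp add: E_def)
        then have "X / sqrt (real N) \<le> \<bar>real_of_int (?S \<omega>)\<bar> / sqrt (real N)" by (intro divide_right_mono) auto
        moreover have "X / sqrt (real N) = real N powr \<delta>"
          using N by (simp add: X_def powr_add powr_half_sqrt)
        ultimately have "exp 1 * exp (- (\<bar>real_of_int (?S \<omega>)\<bar> / sqrt (real N))) \<le> exp 1 * exp (- (real N powr \<delta>))" by simp
        moreover have "srw (n_merged c) (?S \<omega>) \<le> exp 1 * exp (- (\<bar>real_of_int (?S \<omega>)\<bar> / sqrt (real N)))"
          using N by (intro srw_tail k) simp
        ultimately have "srw (n_merged c) (?S \<omega>) \<le> exp 1 * exp (- (real N powr \<delta>))" by linarith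
        then show ?thesis using False by simp
      qed
      have int_ind: "integrable M (indicat_real E)"
        using E by (intro integrable_real_indicator) (auto simp: emeasure_eq_measure)
      have "(\<integral>\<omega>. srw (n_merged c) (?S \<omega>) \<partial>M)
        \<le> (\<integral>\<omega>. 6 * real N powr (- (1/2)) * indicator E \<omega> + exp 1 * exp (- (real N powr \<delta>)) \<partial>M)"
        by (intro integral_mono srw_row_sum_integrable Bochner_Integration.integrable_add
            integrable_mult_right int_ind integrable_const pt)
      also have "\<dots> = 6 * real N powr (- (1/2)) * measure M E + exp 1 * exp (- (real N powr \<delta>))"
        using int_ind E by (subst Bochner_Integration.integral_add) (auto simp: prob_space)
      also have "\<dots> \<le> 6 * real N powr (- (1/2)) * (C * real N powr (- \<delta>)) + real N powr (- (1/2 + \<delta>))"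
        using pE elim(2) by (intro add_mono mult_left_mono) auto
      also have "\<dots> = (6 * C + 1) * real N powr (- (1/2 + \<delta>))"
        using N by (simp add: powr_add[symmetric] algebra_simps)
      finally show "(\<integral>\<omega>. srw (n_merged c) (?S \<omega>) \<partial>M) \<le> (6 * C + 1) * real N powr (- (1/2 + \<delta>))" .
    qed
  qed
  then show ?thesis using that[of \<delta> "6 * C + 1"] \<delta> C by simp
qed

end

section \<open>Almost sure transience\<close>

text \<open>Every step changes the parity of the sum of the coordinates. Pairing only reaches even
  times, and this disposes of the odd ones.\<close>

lemma return_prob_eq_0_parity:
  assumes e: "\<And>y. e y \<in> {-1, 1}"
  shows "odd (int n + x + y) \<Longrightarrow> return_prob e n (x, y) = 0"
proof (induction n arbitrary: x y)
  case (Suc n)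
  have "odd (e y)" using e[of y] by auto
  then have "odd (int n + x + (y + 1))" "odd (int n + x + (y - 1))" "odd (int n + (x + e y) + y)"
    using Suc.prems by auto
  then show ?case using Suc.IH by (simp add: lstep_def)
qed auto

context fkg_orientation
begin

lemma env_pm1: "\<omega> \<in> space M \<Longrightarrow> (\<lambda>y. eps y \<omega>) y \<in> {-1, 1}"
  using eps_cases by auto

lemma return_prob_even_eq:
  assumes "\<omega> \<in> space M"
  shows "return_prob (\<lambda>y. eps y \<omega>) (2 * N) (0, 0)
    = (\<Sum>c\<in>pwords N. srw (n_merged c) (row_sum (\<lambda>y. eps y \<omega>) c 0) * (of_bool (end_row c 0 = 0) / 9 ^ N))"
  using return_prob_eq_pavg[of "\<lambda>y. eps y \<omega>" N 0 0, OF env_pm1[OF assms]]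
  by (simp only: pavg_def sum_divide_distrib times_divide_eq_right add_0)

lemma return_prob_even_integrable: "integrable M (\<lambda>\<omega>. return_prob (\<lambda>y. eps y \<omega>) (2 * N) (0, 0))"
proof -
  have "integrable M (\<lambda>\<omega>. \<Sum>c\<in>pwords N. srw (n_merged c) (row_sum (\<lambda>y. eps y \<omega>) c 0) * (of_bool (end_row c 0 = 0) / 9 ^ N))"
    by (intro Bochner_Integration.integrable_sum integrable_mult_left srw_row_sum_integrable)
  then show ?thesis
    by (rule Bochner_Integration.integrable_cong[THEN iffD2, rotated 2]) (auto simp: return_prob_even_eq)
qed

lemma return_prob_even_integral:
  "(\<integral>\<omega>. return_prob (\<lambda>y. eps y \<omega>) (2 * N) (0, 0) \<partial>M)
    = pavg N (\<lambda>c. (\<integral>\<omega>. srw (n_merged c) (row_sum (\<lambda>y. eps y \<omega>) c 0) \<partial>M) * of_bool (end_row c 0 = 0))"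
proof -
  have "(\<integral>\<omega>. return_prob (\<lambda>y. eps y \<omega>) (2 * N) (0, 0) \<partial>M)
    = (\<integral>\<omega>. (\<Sum>c\<in>pwords N. srw (n_merged c) (row_sum (\<lambda>y. eps y \<omega>) c 0) * (of_bool (end_row c 0 = 0) / 9 ^ N)) \<partial>M)"
    by (intro Bochner_Integration.integral_cong) (auto simp: return_prob_even_eq)
  also have "\<dots> = (\<Sum>c\<in>pwords N. (\<integral>\<omega>. srw (n_merged c) (row_sum (\<lambda>y. eps y \<omega>) c 0) \<partial>M) * (of_bool (end_row c 0 = 0) / 9 ^ N))"
    by (subst Bochner_Integration.integral_sum)
       (intro integrable_mult_left srw_row_sum_integrable, simp)
  finally show ?thesis by (simp only: pavg_def sum_divide_distrib times_divide_eq_right)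
qed

text \<open>Typical words contribute \<open>N^(-(1/2 + \<delta>))\<close> times the probability
  \<open>N^(-1/2)\<close> of vertical return. Atypical ones are bounded by twice their probability,
  which is smaller than any power of \<open>N\<close>.\<close>

lemma expected_return_bound:
  obtains \<delta> C where "0 < \<delta>"
    "eventually (\<lambda>N. (\<integral>\<omega>. return_prob (\<lambda>y. eps y \<omega>) (2 * N) (0, 0) \<partial>M) \<le> C * real N powr (- (1 + \<delta>))) sequentially"
proof -
  obtain \<delta> C where \<delta>: "0 < \<delta>" "\<delta> \<le> 1 / 128" and C: "C > 0" and ev:
    "eventually (\<lambda>N. \<forall>c\<in>pwords N. typical_word \<delta> N c \<longrightarrow>
       (\<integral>\<omega>. srw (n_merged c) (row_sum (\<lambda>y. eps y \<omega>) c 0) \<partial>M) \<le> C * real N powr (- (1/2 + \<delta>))) sequentially"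
    by (rule typical_word_word_bound)
  have ev2: "eventually (\<lambda>N::nat. (98 / 100) ^ N + 2 * exp 4 * exp (- (real N powr \<delta>))
      + (2 * real N powr (1/2 + \<delta>) + 1) * (exp 2 * exp (- (1/2 * real N powr \<delta>))) \<le> real N powr (- (1 + \<delta>))) sequentially"
    using \<delta> by real_asymp
  have "eventually (\<lambda>N. (\<integral>\<omega>. return_prob (\<lambda>y. eps y \<omega>) (2 * N) (0, 0) \<partial>M) \<le> (C * (5 / 2) + 2) * real N powr (- (1 + \<delta>))) sequentially"
    using ev ev2 eventually_ge_at_top[of 1]
  proof eventually_elim
    case (elim N)
    let ?I = "\<lambda>c. (\<integral>\<omega>. srw (n_merged c) (row_sum (\<lambda>y. eps y \<omega>) c 0) \<partial>M)"
    let ?b = "C * real N powr (- (1/2 + \<delta>))"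
    have N: "real N \<ge> 1" using elim by simp
    have "(\<integral>\<omega>. return_prob (\<lambda>y. eps y \<omega>) (2 * N) (0, 0) \<partial>M)
      \<le> pavg N (\<lambda>c. ?b * of_bool (end_row c 0 = 0) + 2 * of_bool (end_row c 0 = 0 \<and> \<not> typical_word \<delta> N c))"
      unfolding return_prob_even_integral
    proof (rule pavg_mono)
      fix c assume c: "c \<in> pwords N"
      have "0 \<le> ?b" using C by simp
      moreover have "?I c \<le> ?b" if "typical_word \<delta> N c" using elim(1) c that by blast
      ultimately show "?I c * of_bool (end_row c 0 = 0)
          \<le> ?b * of_bool (end_row c 0 = 0) + 2 * of_bool (end_row c 0 = 0 \<and> \<not> typical_word \<delta> N c)"
        using srw_row_sum_integral_le_2[of "n_merged c" c 0] by (cases "typical_word \<delta> N c") auto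
    qed
    also have "\<dots> = ?b * lazy_walk (2 * N) 0 + 2 * pavg N (\<lambda>c. of_bool (end_row c 0 = 0 \<and> \<not> typical_word \<delta> N c))"
      by (simp only: pavg_add pavg_cmult lazy_walk_eq_pavg)
    also have "\<dots> \<le> ?b * (5 / 2 * real N powr (- (1/2))) + 2 * real N powr (- (1 + \<delta>))"
    proof (intro add_mono mult_left_mono)
      have "lazy_walk (2 * N) 0 \<le> 5 / 2 / sqrt (real (2 * N) + 1)" by (rule lazy_walk_upper)
      also have "\<dots> \<le> 5 / 2 / sqrt (real N)" using N by (intro divide_left_mono real_sqrt_le_mono) auto
      also have "\<dots> = 5 / 2 * real N powr (- (1/2))"
      proof -
        have "real N powr (- (1/2)) = 1 / sqrt (real N)"
          by (subst powr_minus_divide, subst powr_half_sqrt) auto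
        then show ?thesis by simp
      qed
      finally show "lazy_walk (2 * N) 0 \<le> 5 / 2 * real N powr (- (1/2))" .
      show "pavg N (\<lambda>c. of_bool (end_row c 0 = 0 \<and> \<not> typical_word \<delta> N c)) \<le> real N powr (- (1 + \<delta>))"
        using pavg_bad[OF \<delta>(1), of N] elim(2,3) by linarith
    qed (use C in auto)
    also have "\<dots> = C * (5 / 2) * (real N powr (- (1/2 + \<delta>)) * real N powr (- (1/2))) + 2 * real N powr (- (1 + \<delta>))"
      by simp
    also have "real N powr (- (1/2 + \<delta>)) * real N powr (- (1/2)) = real N powr (- (1 + \<delta>))"
      unfolding powr_add[symmetric] by simp
    finally show ?case by (simp only: distrib_right)
  qed
  then show ?thesis using that \<delta> by blast
qed

text \<open>By Tonelli the expected sum over even times is finite, so the sum is finite for almost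
  every orientation; odd times contribute zero.\<close>

lemma AE_summable_return_prob: "AE \<omega> in M. summable (\<lambda>n. return_prob (\<lambda>y. eps y \<omega>) n (0, 0))"
proof -
  let ?f = "\<lambda>N \<omega>. return_prob (\<lambda>y. eps y \<omega>) (2 * N) (0, 0)"
  obtain \<delta> C where \<delta>: "0 < \<delta>" and
    ev: "eventually (\<lambda>N. (\<integral>\<omega>. ?f N \<omega> \<partial>M) \<le> C * real N powr (- (1 + \<delta>))) sequentially"
    by (rule expected_return_bound)
  have nonneg: "0 \<le> (\<integral>\<omega>. ?f N \<omega> \<partial>M)" for N
    by (intro Bochner_Integration.integral_nonneg return_prob_nonneg)
  have "summable (\<lambda>N. \<integral>\<omega>. ?f N \<omega> \<partial>M)"
  proof (rule summable_comparison_test_ev)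
    show "eventually (\<lambda>N. norm (\<integral>\<omega>. ?f N \<omega> \<partial>M) \<le> C * real N powr (- (1 + \<delta>))) sequentially"
      using ev by eventually_elim (use nonneg in simp)
    show "summable (\<lambda>N. C * real N powr (- (1 + \<delta>)))"
      using \<delta> by (intro summable_mult) (simp add: summable_real_powr_iff)
  qed
  then have "(\<Sum>N. ennreal (\<integral>\<omega>. ?f N \<omega> \<partial>M)) \<noteq> \<infinity>"
    using nonneg by (subst suminf_ennreal2) auto
  also have "(\<Sum>N. ennreal (\<integral>\<omega>. ?f N \<omega> \<partial>M)) = (\<Sum>N. \<integral>\<^sup>+\<omega>. ennreal (?f N \<omega>) \<partial>M)"
    by (intro suminf_cong nn_integral_eq_integral[symmetric] return_prob_even_integrable) (simp add: return_prob_nonneg)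
  also have "\<dots> = (\<integral>\<^sup>+\<omega>. (\<Sum>N. ennreal (?f N \<omega>)) \<partial>M)"
    using borel_measurable_integrable[OF return_prob_even_integrable]
    by (intro nn_integral_suminf[symmetric]) auto
  finally have fin: "(\<integral>\<^sup>+\<omega>. (\<Sum>N. ennreal (?f N \<omega>)) \<partial>M) \<noteq> \<infinity>" .
  have "AE \<omega> in M. (\<Sum>N. ennreal (?f N \<omega>)) \<noteq> \<infinity>"
    using borel_measurable_integrable[OF return_prob_even_integrable]
    by (intro nn_integral_PInf_AE[OF _ fin] borel_measurable_suminf) auto
  then show ?thesis
    using AE_space
  proof eventually_elim
    case (elim \<omega>)
    have "summable (\<lambda>N. ?f N \<omega>)"
      using elim(1) by (intro summable_suminf_not_top) (auto simp: return_prob_nonneg)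
    moreover have "strict_mono (\<lambda>N::nat. 2 * N)" by (auto simp: strict_mono_def)
    moreover have "return_prob (\<lambda>y. eps y \<omega>) n (0, 0) = 0" if "n \<notin> range (\<lambda>N. 2 * N)" for n
    proof (rule return_prob_eq_0_parity)
      show "eps y \<omega> \<in> {-1, 1}" for y using elim(2) eps_cases by auto
      have "odd n" using that by (auto elim!: evenE)
      then show "odd (int n + 0 + 0)" by simp
    qed
    ultimately show ?case
      using summable_mono_reindex[of "\<lambda>N. 2 * N" "\<lambda>n. return_prob (\<lambda>y. eps y \<omega>) n (0, 0)"] by simp
  qed
qed

end

theorem theorem2p2:
  fixes M :: "'a measure" and eps :: "int \<Rightarrow> 'a \<Rightarrow> int"
  assumes "orientation_assumptions M eps"
  shows "AE \<omega> in M. transient (\<lambda>y. eps y \<omega>)"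
proof -
  interpret prob_space M using assms by (simp add: orientation_assumptions_def)
  interpret fkg_orientation M eps by unfold_locales (rule assms)
  show ?thesis using AE_summable_return_prob by eventually_elim (rule transient_if_summable)
qed

end
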